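(* For each integer $d \geq 2$ and each $0 < \alpha < 1$, there exist constants $C_{d,\alpha}>0$ and $D_{d,\alpha}$ such that for all sufficiently large $n$, $$C_{d,\alpha}\, I(n) < M^{\alpha}_{2,d}(n) < D_{d,\alpha}\, I(n).$$
   Context: A flag complex is a simplicial complex in which a set is a face whenever all its 2-element subsets are edges. Given a finite set $S \subset \mathbb{R}^d$ and $0<\alpha<1$, a quasi-Rips complex with parameter $\alpha$ on $S$ is a flag complex with vertex set $S$ that contains the edge $uv$ whenever $\mathrm{dist}(u,v) \leq \alpha$ and does not contain the edge $uv$ whenever $\mathrm{dist}(u,v) > 1$ (edges with $\alpha < \mathrm{dist}(u,v) \leq 1$ may be included or excluded arbitrarily). Let $Q^\alpha_d(n)$ be the set of all quasi-Rips complexes with parameter $\alpha$ on subsets $S \subset \mathbb{R}^d$ with $|S| \le n$, and $M^{\alpha}_{p,d}(n) := \max\{\tilde{\beta}_p(\Gamma) : \Gamma \in Q^\alpha_d(n)\}$, where $\tilde{\beta}_p$ is the $p$-th reduced Betti number over a fixed field. In a bipartite graph with parts $U,V$, a matching is a set of edges no two sharing an endpoint; it is an induced matching if whenever $uv, u'v'$ are in it ($u,u'\in U$, $v,v'\in V$) the graph contains neither $uv'$ nor $u'v$. $I(n)$ denotes the maximum of $\sum_{i=1}^t |M_i|$ over all bipartite graphs $G$ with parts $U,V$, $|U|,|V| \le n$, and all families $M_1,\dots,M_t$ with $t \le n$ of pairwise disjoint induced matchings in $G$. *)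

theory Defs
  imports "HOL-Analysis.Analysis" "HOL-Library.Function_Algebras" "HOL-Library.Disjoint_Sets"
begin

section \<open>Simplicial complexes and reduced Betti numbers\<close>

definition simplicial_complex :: "'a set \<Rightarrow> 'a set set \<Rightarrow> bool" where
  "simplicial_complex V K \<longleftrightarrow>
     (\<forall>\<sigma>\<in>K. finite \<sigma> \<and> \<sigma> \<subseteq> V) \<and> {} \<in> K \<and> (\<forall>v\<in>V. {v} \<in> K) \<and>
     (\<forall>\<sigma>\<in>K. \<forall>\<tau>\<subseteq>\<sigma>. \<tau> \<in> K)"

definition flag_complex :: "'a set \<Rightarrow> 'a set set \<Rightarrow> bool" where
  "flag_complex V K \<longleftrightarrow> simplicial_complex V K \<and>
     (\<forall>\<sigma>\<subseteq>V. finite \<sigma> \<longrightarrow> (\<forall>e\<subseteq>\<sigma>. card e = 2 \<longrightarrow> e \<in> K) \<longrightarrow> \<sigma> \<in> K)"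

interpretation chain_space: vector_space "\<lambda>(a::'k::field) (c::'a list \<Rightarrow> 'k) xs. a * c xs"
  by unfold_locales (auto simp: algebra_simps fun_eq_iff)

text \<open>
  Oriented simplicial chains on the faces with \<open>k\<close> vertices (so of dimension \<open>k - 1\<close>): functions on
  oriented faces that change sign when the orientation is reversed. An oriented face is given by
  an enumeration of its vertices, and two orientations of a face are compared through adjacent
  transpositions. The case \<open>k = 0\<close>, with the empty face as only face, is the augmentation term
  of the reduced complex.
\<close>

definition oriented_chains :: "'a set set \<Rightarrow> nat \<Rightarrow> ('a list \<Rightarrow> 'k::field) set" where
  "oriented_chains K k = {c. (\<forall>xs. c xs \<noteq> 0 \<longrightarrow> length xs = k \<and> distinct xs \<and> set xs \<in> K) \<and>
                             (\<forall>us v w ws. c (us @ v # w # ws) = - c (us @ w # v # ws))}"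

text \<open>
  The oriented faces having \<open>ys\<close> in their boundary with coefficient \<open>1\<close> are those of the form
  \<open>v # ys\<close>, so the coefficient of \<open>ys\<close> in the boundary of \<open>c\<close> is the sum of all \<open>c (v # ys)\<close>.
  Only meant for complexes with a finite vertex set.
\<close>

definition boundary :: "'a set set \<Rightarrow> ('a list \<Rightarrow> 'k::field) \<Rightarrow> 'a list \<Rightarrow> 'k" where
  "boundary K c ys = (\<Sum>v\<in>\<Union>K. c (v # ys))"

definition cycles :: "'a set set \<Rightarrow> nat \<Rightarrow> ('a list \<Rightarrow> 'k::field) set" where
  "cycles K k = {c \<in> oriented_chains K k. boundary K c = (\<lambda>_. 0)}"

definition boundaries :: "'a set set \<Rightarrow> nat \<Rightarrow> ('a list \<Rightarrow> 'k::field) set" where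
  "boundaries K k = boundary K ` oriented_chains K (Suc k)"

lemma boundary_in_oriented_chains:
  assumes "simplicial_complex V K" "c \<in> oriented_chains K (Suc k)"
  shows "boundary K c \<in> oriented_chains K k"
proof -
  have supp: "length ys = k \<and> distinct ys \<and> set ys \<in> K" if "boundary K c ys \<noteq> 0" for ys
  proof -
    obtain v where "c (v # ys) \<noteq> 0"
      using \<open>boundary K c ys \<noteq> 0\<close> unfolding boundary_def by (meson sum.neutral)
    then have "length (v # ys) = Suc k" "distinct (v # ys)" "set (v # ys) \<in> K"
      using assms(2) unfolding oriented_chains_def by blast+
    moreover from this(3) have "set ys \<in> K"
      using assms(1) by (auto simp: simplicial_complex_def)
    ultimately show ?thesis by auto
  qed
  have alt: "c (us @ v # w # ws) = - c (us @ w # v # ws)" for us v w ws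
    using assms(2) unfolding oriented_chains_def by blast
  have "boundary K c (us @ v # w # ws) = - boundary K c (us @ w # v # ws)" for us v w ws
    unfolding boundary_def sum_negf[symmetric]
    by (intro sum.cong refl alt[of "_ # us" v w ws, unfolded append_Cons])
  with supp show ?thesis unfolding oriented_chains_def by blast
qed

lemma boundaries_subset_cycles:
  assumes "simplicial_complex V K" "finite V"
  shows "boundaries K k \<subseteq> cycles K k"
proof
  fix b assume "b \<in> boundaries K k"
  then obtain c where c: "c \<in> oriented_chains K (Suc k)" and b: "b = boundary K c"
    by (auto simp: boundaries_def)
  have alt: "c (v # w # ws) = - c (w # v # ws)" for v w ws
  proof -
    have "c ([] @ v # w # ws) = - c ([] @ w # v # ws)"
      using c unfolding oriented_chains_def by blast
    then show ?thesis unfolding append_Nil .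
  qed
  have diag: "c (v # v # ws) = 0" for v ws
  proof (rule ccontr)
    assume "c (v # v # ws) \<noteq> 0"
    then have "distinct (v # v # ws)"
      using c unfolding oriented_chains_def by blast
    then show False by simp
  qed
  have "\<Union>K \<subseteq> V"
    using assms(1) by (auto simp: simplicial_complex_def)
  then have fin: "finite (\<Union>K)"
    using assms(2) by (rule finite_subset)
  have dbl: "(\<Sum>w\<in>A. \<Sum>v\<in>A. c (v # w # ws)) = 0" if "finite A" for A ws
    using that
  proof (induction A rule: finite_induct)
    case (insert x A)
    have "(\<Sum>w\<in>A. c (x # w # ws)) + (\<Sum>v\<in>A. c (v # x # ws)) = 0"
      unfolding sum.distrib[symmetric] by (intro sum.neutral ballI) (metis add.left_inverse alt)
    with insert show ?case
      by (simp add: sum.distrib diag add.assoc[symmetric])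
  qed simp
  have "boundary K b = (\<lambda>_. 0)"
    by (simp add: b boundary_def fun_eq_iff dbl fin)
  with boundary_in_oriented_chains[OF assms(1) c] show "b \<in> cycles K k"
    by (simp add: cycles_def b)
qed

text \<open>
  The dimension of the quotient of cycles by boundaries over the field \<open>'k\<close>. The natural number
  subtraction does not truncate, since boundaries are cycles.
\<close>

definition reduced_betti :: "'k::field itself \<Rightarrow> nat \<Rightarrow> 'a set set \<Rightarrow> nat" where
  "reduced_betti _ p K =
     chain_space.dim (cycles K (Suc p) :: ('a list \<Rightarrow> 'k) set) -
     chain_space.dim (boundaries K (Suc p) :: ('a list \<Rightarrow> 'k) set)"

section \<open>Quasi-Rips complexes\<close>

definition quasi_rips :: "real \<Rightarrow> (real ^ 'd) set \<Rightarrow> (real ^ 'd) set set \<Rightarrow> bool" where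
  "quasi_rips \<alpha> S \<Gamma> \<longleftrightarrow> flag_complex S \<Gamma> \<and>
     (\<forall>u\<in>S. \<forall>v\<in>S. u \<noteq> v \<longrightarrow>
        (dist u v \<le> \<alpha> \<longrightarrow> {u, v} \<in> \<Gamma>) \<and> (dist u v > 1 \<longrightarrow> {u, v} \<notin> \<Gamma>))"

definition quasi_rips_complexes :: "real \<Rightarrow> nat \<Rightarrow> (real ^ 'd) set set set" where
  "quasi_rips_complexes \<alpha> n = {\<Gamma>. \<exists>S. finite S \<and> card S \<le> n \<and> quasi_rips \<alpha> S \<Gamma>}"

definition max_betti :: "'k::field itself \<Rightarrow> 'd::finite itself \<Rightarrow> real \<Rightarrow> nat \<Rightarrow> nat \<Rightarrow> nat" where
  "max_betti _ _ \<alpha> p n =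
     Max {reduced_betti TYPE('k) p \<Gamma> | \<Gamma>. \<Gamma> \<in> (quasi_rips_complexes \<alpha> n :: (real ^ 'd) set set set)}"

section \<open>Disjoint induced matchings in bipartite graphs\<close>

text \<open>
  A bipartite graph with parts \<open>U\<close> and \<open>V\<close> is given by its set of edges, each written as the pair
  of its endpoint in \<open>U\<close> and its endpoint in \<open>V\<close>. Finite graphs may be taken on vertices in \<open>nat\<close>.
\<close>

definition bipartite_graph :: "'a set \<Rightarrow> 'a set \<Rightarrow> ('a \<times> 'a) set \<Rightarrow> bool" where
  "bipartite_graph U V E \<longleftrightarrow> U \<inter> V = {} \<and> E \<subseteq> U \<times> V"

definition matching :: "('a \<times> 'a) set \<Rightarrow> ('a \<times> 'a) set \<Rightarrow> bool" where
  "matching E M \<longleftrightarrow> M \<subseteq> E \<and>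
     (\<forall>(u, v)\<in>M. \<forall>(u', v')\<in>M. (u, v) \<noteq> (u', v') \<longrightarrow> u \<noteq> u' \<and> v \<noteq> v')"

definition induced_matching :: "('a \<times> 'a) set \<Rightarrow> ('a \<times> 'a) set \<Rightarrow> bool" where
  "induced_matching E M \<longleftrightarrow> matching E M \<and>
     (\<forall>(u, v)\<in>M. \<forall>(u', v')\<in>M. (u, v) \<noteq> (u', v') \<longrightarrow> (u, v') \<notin> E \<and> (u', v) \<notin> E)"

definition max_induced_matchings :: "nat \<Rightarrow> nat" where
  "max_induced_matchings n =
     Max {\<Sum>i = 1..t. card (M i) | (U :: nat set) V E t M.
            finite U \<and> finite V \<and> card U \<le> n \<and> card V \<le> n \<and> bipartite_graph U V E \<and>
            t \<le> n \<and> (\<forall>i\<in>{1..t}. induced_matching E (M i)) \<and> disjoint_family_on M {1..t}}"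

end

theory Submission
  imports Defs
begin

text \<open>
  Upper bound. Cut space into cells of diameter at most \<open>\<alpha>\<close> and colour the cells periodically with
  boundedly many colours, so that the neighbours of a vertex in one colour class form a clique. Remove
  the vertices one at a time: by Mayer--Vietoris the second Betti number drops at most by the first Betti
  number of the link of the removed vertex \<open>v\<close>. Modulo boundaries, the 1-cycles of this link are generated
  by paths that run from a base point of one clique to a base point of another through a single edge, and
  edges of the same two colours that share an end point, or are joined by an edge, give the same generator.
  Hence a minimal set of edges needed for a pair of colours is an induced matching. Edges that already form
  a triangle with an earlier vertex of the colour of \<open>v\<close> are not needed, so these matchings are
  disjoint for distinct \<open>v\<close> of the same colour, and the Betti number is at most (number of colours)\<open>^3 * I(n)\<close>.

  Lower bound. Place \<open>U\<close>, \<open>V\<close> and the set of indices of the matchings as three small clusters with mutual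
  distances between \<open>\<alpha>\<close> and \<open>1\<close>, join index \<open>i\<close> to the end points of \<open>M\<^sub>i\<close>, and add one apex joined to
  \<open>U\<close> and \<open>V\<close>. For an edge \<open>uv\<close> of \<open>M\<^sub>i\<close> the triangle \<open>iuv\<close> is a facet, and together with a fixed edge of
  \<open>M\<^sub>i\<close> it lies on an octahedron with poles \<open>i\<close> and the apex, so all but one edge of each
  \<open>M\<^sub>i\<close> contribute an independent class.
\<close>

section \<open>Spans and dimensions\<close>

text \<open>Each element \<open>t\<close> of \<open>T\<close> costs at most one extra generator: the
  elements of \<open>A\<close> whose image avoids \<open>t\<close> form a subspace of codimension at
  most one in \<open>A\<close>, so a single \<open>a0\<close> outside it generates the rest. In the
  application \<open>\<phi>\<close> is contraction with a vertex.\<close>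

lemma (in vector_space) span_pullback:
  assumes "finite T" "subspace A"
    and add: "\<And>x y. \<phi> (x + y) = \<phi> x + \<phi> y"
    and scale: "\<And>r x. \<phi> (scale r x) = scale r (\<phi> x)"
    and img: "\<phi> ` A \<subseteq> span (B \<union> T)"
  shows "\<exists>T'. finite T' \<and> card T' \<le> card T \<and> A \<subseteq> span ({a \<in> A. \<phi> a \<in> span B} \<union> T')"
  using assms(1,2) img
proof (induction T arbitrary: A rule: finite_induct)
  case empty
  then show ?case by (intro exI[of _ "{}"]) (auto intro: span_base)
next
  case (insert t T)
  have diff: "\<phi> (x - y) = \<phi> x - \<phi> y" for x y
    using add[of "x - y" y] by simp
  have zero: "\<phi> 0 = 0"
    using add[of 0 0] by simp
  define A' where "A' = {a \<in> A. \<phi> a \<in> span (B \<union> T)}"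
  have sub: "subspace A'"
    using \<open>subspace A\<close> by (auto simp: subspace_def A'_def zero add scale span_zero span_add span_scale)
  obtain T1 where T1: "finite T1" "card T1 \<le> card T"
    "A' \<subseteq> span ({a \<in> A'. \<phi> a \<in> span B} \<union> T1)"
    using insert.IH[OF sub] by (auto simp: A'_def)
  have A'_sub: "A' \<subseteq> span ({a \<in> A. \<phi> a \<in> span B} \<union> T1)"
    using T1(3) span_mono[of "{a \<in> A'. \<phi> a \<in> span B} \<union> T1" "{a \<in> A. \<phi> a \<in> span B} \<union> T1"]
    by (auto simp: A'_def)
  show ?case
  proof (cases "A \<subseteq> A'")
    case True
    then show ?thesis
      using T1(1,2) A'_sub insert.hyps by (intro exI[of _ T1]) auto
  next
    case False
    then obtain a0 where a0: "a0 \<in> A" "a0 \<notin> A'" by auto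
    have ex: "\<exists>k. \<phi> a - scale k t \<in> span (B \<union> T)" if "a \<in> A" for a
      using insert.prems(2) that span_breakdown_eq[of "\<phi> a" t "B \<union> T"] by auto
    obtain k0 where k0: "\<phi> a0 - scale k0 t \<in> span (B \<union> T)" using ex[OF a0(1)] by blast
    have "k0 \<noteq> 0" using k0 a0 by (auto simp: A'_def)
    have "a \<in> span ({a \<in> A. \<phi> a \<in> span B} \<union> insert a0 T1)" if aA: "a \<in> A" for a
    proof -
      obtain k where k: "\<phi> a - scale k t \<in> span (B \<union> T)" using ex[OF aA] by blast
      \<comment> \<open>This ratio cancels the multiples of \<open>t\<close> in the images of
        \<open>a\<close> and \<open>a0\<close>.\<close>
      define r where "r = k / k0"
      have "\<phi> (a - scale r a0) = (\<phi> a - scale k t) - scale r (\<phi> a0 - scale k0 t)"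
        using \<open>k0 \<noteq> 0\<close> by (simp add: diff scale r_def scale_right_diff_distrib)
      then have "a - scale r a0 \<in> A'"
        using k k0 \<open>subspace A\<close> aA a0
        by (auto simp: A'_def intro!: span_diff span_scale subspace_diff subspace_scale)
      then have "a - scale r a0 \<in> span ({a \<in> A. \<phi> a \<in> span B} \<union> insert a0 T1)"
        using A'_sub span_mono[of "{a \<in> A. \<phi> a \<in> span B} \<union> T1" "{a \<in> A. \<phi> a \<in> span B} \<union> insert a0 T1"]
        by auto
      moreover have "scale r a0 \<in> span ({a \<in> A. \<phi> a \<in> span B} \<union> insert a0 T1)"
        by (intro span_scale span_base) auto
      ultimately have "(a - scale r a0) + scale r a0 \<in> span ({a \<in> A. \<phi> a \<in> span B} \<union> insert a0 T1)"
        by (rule span_add)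
      then show ?thesis by simp
    qed
    then show ?thesis
      using T1(1,2) insert.hyps
      by (intro exI[of _ "insert a0 T1"]) (auto intro: order_trans[OF card_insert_le_m1] simp: card_insert_if)
  qed
qed

lemma (in vector_space) finite_basis_exists:
  assumes "finite F" "A \<subseteq> span F"
  obtains b where "b \<subseteq> A" "independent b" "A \<subseteq> span b" "finite b" "card b = dim A"
proof -
  obtain b where b: "b \<subseteq> A" "independent b" "A \<subseteq> span b" "card b = dim A"
    using basis_exists by blast
  then have "finite b" using independent_span_bound[OF assms(1), of b] assms(2) by auto
  with b that show ?thesis by blast
qed

text \<open>The finite set \<open>F\<close> guarantees finite bases; \<open>dim\<close> is the
  \<open>card\<close> of a basis and would be 0 for an infinite one.\<close>

lemma (in vector_space) dim_le_dim_plus_card: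
  assumes "finite F" "A \<subseteq> span F" "B \<subseteq> span F" "finite T" "A \<subseteq> span (B \<union> T)"
  shows "dim A \<le> dim B + card T"
proof -
  obtain a where a: "a \<subseteq> A" "independent a" "finite a" "card a = dim A"
    using finite_basis_exists[OF assms(1,2)] by metis
  obtain b where b: "b \<subseteq> B" "B \<subseteq> span b" "finite b" "card b = dim B"
    using finite_basis_exists[OF assms(1,3)] by metis
  have "B \<union> T \<subseteq> span (b \<union> T)"
    using b(2) span_mono[of b "b \<union> T"] span_superset[of "b \<union> T"] by auto
  then have "span (B \<union> T) \<subseteq> span (b \<union> T)" by (simp add: span_minimal)
  then have "card a \<le> card (b \<union> T)"
    using independent_span_bound[of "b \<union> T" a] a assms b by auto
  also have "\<dots> \<le> dim B + card T" using card_Un_le[of b T] b by simp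
  finally show ?thesis using a by simp
qed

text \<open>The functionals \<open>f j\<close> witness independence: \<open>f i\<close> vanishes on
  \<open>B\<close> and on every \<open>z j\<close> other than \<open>z i\<close>, so
  \<open>z i\<close> is outside the span of what was collected before it, and a basis of
  \<open>B\<close> extends by all the \<open>z j\<close>.\<close>

lemma (in vector_space) dim_plus_card_le_dim:
  assumes "finite F" "A \<subseteq> span F" "B \<subseteq> A" "finite J" "\<And>j. j \<in> J \<Longrightarrow> z j \<in> A"
    and add: "\<And>j x y. j \<in> J \<Longrightarrow> f j (x + y) = f j x + f j y"
    and scale: "\<And>j r x. j \<in> J \<Longrightarrow> f j (scale r x) = r * f j x"
    and van: "\<And>j x. j \<in> J \<Longrightarrow> x \<in> B \<Longrightarrow> f j x = 0"
    and dual: "\<And>i j. i \<in> J \<Longrightarrow> j \<in> J \<Longrightarrow> f i (z j) = (if i = j then 1 else 0)"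
  shows "dim B + card J \<le> dim A"
proof -
  obtain a where a: "a \<subseteq> A" "A \<subseteq> span a" "finite a" "card a = dim A"
    using finite_basis_exists[OF assms(1,2)] by metis
  obtain b where b: "b \<subseteq> B" "independent b" "finite b" "card b = dim B"
    using finite_basis_exists[OF assms(1), of B] assms(2,3) by (metis order_trans)
  have "independent (b \<union> z ` I) \<and> card (b \<union> z ` I) = card b + card I" if "finite I" "I \<subseteq> J" for I
    using that
  proof (induction I rule: finite_induct)
    case empty
    then show ?case using b by simp
  next
    case (insert i I)
    then have i: "i \<in> J" by simp
    have "subspace {x. f i x = 0}"
      using scale[OF i, of 0 0] by (auto simp: subspace_def add[OF i] scale[OF i])
    moreover have "b \<union> z ` I \<subseteq> {x. f i x = 0}"
      using b(1) van[OF i] dual[OF i] insert by auto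
    ultimately have "span (b \<union> z ` I) \<subseteq> {x. f i x = 0}" by (simp add: span_minimal)
    then have nin: "z i \<notin> span (b \<union> z ` I)" using dual[OF i i] by auto
    then have "z i \<notin> b \<union> z ` I" using span_superset[of "b \<union> z ` I"] by (meson subsetD)
    moreover have "independent (insert (z i) (b \<union> z ` I))"
      using insert nin by (intro independent_insertI) auto
    ultimately show ?case using insert b(3) by simp
  qed
  from this[OF assms(4)] have "independent (b \<union> z ` J)" "card (b \<union> z ` J) = dim B + card J"
    using b by auto
  moreover have "b \<union> z ` J \<subseteq> span a" using a b assms by blast
  ultimately show ?thesis using independent_span_bound[OF a(3)] a(4) by metis
qed

text \<open>Take \<open>M\<close> of least cardinality: of two members with images congruent modulo
  \<open>span B\<close>, one could be dropped. This weak form of minimality is what turns a set of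
  edges into an induced matching later.\<close>

lemma (in vector_space) minimal_spanning_image:
  assumes "finite F"
  obtains M where "M \<subseteq> F" "f ` F \<subseteq> span (B \<union> f ` M)"
    "\<And>x y. x \<in> M \<Longrightarrow> y \<in> M \<Longrightarrow> f x - f y \<in> span B \<Longrightarrow> x = y"
proof -
  define P where "P M \<longleftrightarrow> M \<subseteq> F \<and> f ` F \<subseteq> span (B \<union> f ` M)" for M
  have "P F" by (auto simp: P_def intro: span_base)
  then obtain M where M: "P M" and min: "\<And>M'. P M' \<Longrightarrow> card M \<le> card M'"
    using ex_has_least_nat[of P F card] by blast
  have "x = y" if xy: "x \<in> M" "y \<in> M" "f x - f y \<in> span B" for x y
  proof (rule ccontr)
    assume "x \<noteq> y"
    define M' where "M' = M - {x}"
    have "f x - f y \<in> span (B \<union> f ` M')" using xy(3) span_mono[of B "B \<union> f ` M'"] by auto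
    moreover have "f y \<in> span (B \<union> f ` M')"
      using xy \<open>x \<noteq> y\<close> by (auto simp: M'_def intro: span_base)
    ultimately have "f x \<in> span (B \<union> f ` M')" using span_add by fastforce
    then have "B \<union> f ` M \<subseteq> span (B \<union> f ` M')"
      by (auto simp: M'_def intro: span_base)
    then have "span (B \<union> f ` M) \<subseteq> span (B \<union> f ` M')" by (simp add: span_minimal)
    then have "P M'" using M by (auto simp: P_def M'_def)
    moreover have "card M' < card M"
      using xy(1) M assms finite_subset unfolding M'_def P_def by (metis card_Diff1_less)
    ultimately show False using min by fastforce
  qed
  then show ?thesis using M by (intro that[of M]) (auto simp: P_def)
qed

section \<open>Oriented chains\<close>

abbreviation chain_scale :: "'k::field \<Rightarrow> ('a list \<Rightarrow> 'k) \<Rightarrow> 'a list \<Rightarrow> 'k" where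
  "chain_scale r c \<equiv> (\<lambda>xs. r * c xs)"

lemma oriented_chainsI:
  assumes "\<And>xs. c xs \<noteq> 0 \<Longrightarrow> length xs = k \<and> distinct xs \<and> set xs \<in> K"
    and "\<And>us v w ws. c (us @ v # w # ws) = - c (us @ w # v # ws)"
  shows "c \<in> oriented_chains K k"
  using assms unfolding oriented_chains_def by blast

lemma oriented_chains_support:
  assumes "c \<in> oriented_chains K k" "c xs \<noteq> 0"
  shows "length xs = k" "distinct xs" "set xs \<in> K"
  using assms unfolding oriented_chains_def by blast+

lemma oriented_chains_swap:
  assumes "c \<in> oriented_chains K k"
  shows "c (us @ v # w # ws) = - c (us @ w # v # ws)"
  using assms unfolding oriented_chains_def by blast

lemma subspace_oriented_chains:
  "chain_space.subspace (oriented_chains (K :: 'a set set) k :: ('a list \<Rightarrow> 'k::field) set)"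
proof (rule chain_space.subspaceI)
  show "0 \<in> oriented_chains K k" by (rule oriented_chainsI) auto
next
  fix c c' :: "'a list \<Rightarrow> 'k" assume cc: "c \<in> oriented_chains K k" "c' \<in> oriented_chains K k"
  show "c + c' \<in> oriented_chains K k"
  proof (rule oriented_chainsI)
    fix xs assume "(c + c') xs \<noteq> 0"
    then have "c xs \<noteq> 0 \<or> c' xs \<noteq> 0" by auto
    then show "length xs = k \<and> distinct xs \<and> set xs \<in> K"
      using cc oriented_chains_support by blast
  next
    fix us v w ws
    show "(c + c') (us @ v # w # ws) = - (c + c') (us @ w # v # ws)"
      using cc[THEN oriented_chains_swap, of us v w ws] by simp
  qed
next
  fix r :: 'k and c :: "'a list \<Rightarrow> 'k" assume c: "c \<in> oriented_chains K k"
  show "chain_scale r c \<in> oriented_chains K k"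
  proof (rule oriented_chainsI)
    fix xs assume "r * c xs \<noteq> 0"
    then show "length xs = k \<and> distinct xs \<and> set xs \<in> K"
      using c oriented_chains_support by (metis mult_zero_right)
  next
    fix us v w ws
    show "r * c (us @ v # w # ws) = - (r * c (us @ w # v # ws))"
      using oriented_chains_swap[OF c, of us v w ws] by simp
  qed
qed

lemma oriented_chains_mono: "K \<subseteq> K' \<Longrightarrow> oriented_chains K k \<subseteq> oriented_chains K' k"
  unfolding oriented_chains_def by blast

lemma boundary_add: "boundary K (c + c') = boundary K c + boundary K c'"
  by (simp add: boundary_def fun_eq_iff sum.distrib)

lemma boundary_scale: "boundary K (chain_scale r c) = chain_scale r (boundary K c)"
  by (simp add: boundary_def fun_eq_iff sum_distrib_left)

lemma subspace_boundary_image: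
  assumes "chain_space.subspace C"
  shows "chain_space.subspace (boundary K ` C)"
proof (rule chain_space.subspaceI)
  have "boundary K 0 = 0" by (simp add: boundary_def fun_eq_iff)
  then show "0 \<in> boundary K ` C" using chain_space.subspace_0[OF assms] by (metis imageI)
next
  fix x y assume "x \<in> boundary K ` C" "y \<in> boundary K ` C"
  then obtain c c' where "c \<in> C" "x = boundary K c" "c' \<in> C" "y = boundary K c'" by blast
  then show "x + y \<in> boundary K ` C"
    using chain_space.subspace_add[OF assms, of c c'] boundary_add[of K c c'] by (metis imageI)
next
  fix r x assume "x \<in> boundary K ` C"
  then obtain c where "c \<in> C" "x = boundary K c" by blast
  then show "chain_scale r x \<in> boundary K ` C"
    using chain_space.subspace_scale[OF assms, of c r] boundary_scale[of K r c] by (metis imageI)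
qed

text \<open>Keeping \<open>boundary K\<close> for chains on a smaller complex \<open>L\<close> lets
  one operator serve \<open>K\<close>, its links and its initial parts.\<close>

lemma boundary_in_subcomplex:
  assumes "c \<in> oriented_chains L (Suc k)" "\<And>\<sigma> \<tau>. \<sigma> \<in> L \<Longrightarrow> \<tau> \<subseteq> \<sigma> \<Longrightarrow> \<tau> \<in> L"
  shows "boundary K c \<in> oriented_chains L k"
proof (rule oriented_chainsI)
  fix ys assume "boundary K c ys \<noteq> 0"
  then obtain v where "c (v # ys) \<noteq> 0" unfolding boundary_def by (meson sum.neutral)
  from oriented_chains_support[OF assms(1) this] assms(2)[of "set (v # ys)" "set ys"]
  show "length ys = k \<and> distinct ys \<and> set ys \<in> L" by auto
next
  fix us v w ws
  show "boundary K c (us @ v # w # ws) = - boundary K c (us @ w # v # ws)"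
    unfolding boundary_def sum_negf[symmetric]
    by (intro sum.cong refl oriented_chains_swap[OF assms(1), of "_ # us" v w ws, unfolded append_Cons])
qed

lemma oriented_chains_finite_span:
  assumes "finite S" "\<And>\<sigma>. \<sigma> \<in> K \<Longrightarrow> \<sigma> \<subseteq> S"
  obtains F :: "('a list \<Rightarrow> 'k::field) set" where "finite F" "oriented_chains K k \<subseteq> chain_space.span F"
proof
  define X where "X = {xs. set xs \<subseteq> S \<and> length xs = k}"
  \<comment> \<open>The functions \<open>\<delta> xs\<close> need not be alternating; they only have
    to span a finite-dimensional space that contains the chains.\<close>
  define \<delta> :: "'a list \<Rightarrow> 'a list \<Rightarrow> 'k" where "\<delta> = (\<lambda>xs ys. if ys = xs then 1 else 0)"
  have finX: "finite X" unfolding X_def using finite_lists_length_eq[OF assms(1)] .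
  then show "finite (\<delta> ` X)" by simp
  show "oriented_chains K k \<subseteq> chain_space.span (\<delta> ` X)"
  proof
    fix c :: "'a list \<Rightarrow> 'k" assume c: "c \<in> oriented_chains K k"
    have "c ys = (\<Sum>xs\<in>X. chain_scale (c xs) (\<delta> xs)) ys" for ys
    proof -
      have "c ys = 0" if "ys \<notin> X"
        using that oriented_chains_support[OF c, of ys] assms(2) by (auto simp: X_def)
      moreover have "(\<Sum>xs\<in>X. chain_scale (c xs) (\<delta> xs)) ys = (\<Sum>xs\<in>X. c xs * \<delta> xs ys)"
        using finX by (induction X rule: finite_induct) auto
      moreover have "\<dots> = (\<Sum>xs\<in>X. if ys = xs then c ys else 0)"
        by (intro sum.cong) (auto simp: \<delta>_def)
      ultimately show ?thesis using finX by auto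
    qed
    then have "c = (\<Sum>xs\<in>X. chain_scale (c xs) (\<delta> xs))" by blast
    also have "\<dots> \<in> chain_space.span (\<delta> ` X)"
      by (intro chain_space.span_sum chain_space.span_scale chain_space.span_base) auto
    finally show "c \<in> chain_space.span (\<delta> ` X)" .
  qed
qed

section \<open>Exterior products of functions on the vertices\<close>

definition ind :: "'a \<Rightarrow> 'a \<Rightarrow> 'k::field" where
  "ind a x = (if x = a then 1 else 0)"

text \<open>The exterior product of two functions, evaluated as a 2-by-2 determinant, so that the
  sign rule of oriented chains is automatic. For \<open>ind a\<close> and \<open>ind b\<close> it is
  the oriented edge from \<open>a\<close> to \<open>b\<close>.\<close>

definition wedge2 :: "('a \<Rightarrow> 'k::field) \<Rightarrow> ('a \<Rightarrow> 'k) \<Rightarrow> 'a list \<Rightarrow> 'k" where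
  "wedge2 f g xs = (case xs of [x, y] \<Rightarrow> f x * g y - f y * g x | _ \<Rightarrow> 0)"

text \<open>The 3-by-3 determinant expanded along its first vertex, which is the vertex that
  \<open>boundary\<close> sums over.\<close>

definition wedge3 :: "('a \<Rightarrow> 'k::field) \<Rightarrow> ('a \<Rightarrow> 'k) \<Rightarrow> ('a \<Rightarrow> 'k) \<Rightarrow> 'a list \<Rightarrow> 'k" where
  "wedge3 f g h xs = (case xs of x # ys \<Rightarrow>
     f x * wedge2 g h ys - g x * wedge2 f h ys + h x * wedge2 f g ys | _ \<Rightarrow> 0)"

lemma wedge2_simps [simp]:
  "wedge2 f g [x, y] = f x * g y - f y * g x"
  "wedge2 f g [] = 0" "wedge2 f g [x] = 0" "wedge2 f g (x # y # z # zs) = 0"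
  by (simp_all add: wedge2_def)

lemma wedge3_simps [simp]:
  "wedge3 f g h (x # ys) = f x * wedge2 g h ys - g x * wedge2 f h ys + h x * wedge2 f g ys"
  "wedge3 f g h [] = 0"
  by (simp_all add: wedge3_def)

lemma wedge2_support: "wedge2 f g xs \<noteq> 0 \<Longrightarrow> \<exists>x y. xs = [x, y] \<and> x \<noteq> y"
  by (auto simp: wedge2_def split: list.splits)

lemma wedge3_support:
  assumes "wedge3 f g h xs \<noteq> 0"
  shows "\<exists>x y z. xs = [x, y, z] \<and> distinct [x, y, z]"
proof -
  obtain x ys where xs: "xs = x # ys" using assms by (cases xs) auto
  have "wedge2 g h ys \<noteq> 0 \<or> wedge2 f h ys \<noteq> 0 \<or> wedge2 f g ys \<noteq> 0"
    using assms xs by (metis add.right_neutral diff_zero mult_zero_right wedge3_simps(1))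
  then obtain y z where "ys = [y, z]" "y \<noteq> z" using wedge2_support by metis
  then show ?thesis using assms xs by (auto simp: algebra_simps)
qed

lemma wedge2_in_oriented_chains:
  assumes "\<And>x y. wedge2 f g [x, y] \<noteq> 0 \<Longrightarrow> {x, y} \<in> K"
  shows "wedge2 f g \<in> oriented_chains K 2"
proof (rule oriented_chainsI)
  fix xs assume "wedge2 f g xs \<noteq> 0"
  with wedge2_support[OF this] show "length xs = 2 \<and> distinct xs \<and> set xs \<in> K"
    using assms by fastforce
next
  fix us ws :: "'a list" and v w :: 'a
  show "wedge2 f g (us @ v # w # ws) = - wedge2 f g (us @ w # v # ws)"
  proof (cases us)
    case Nil
    then show ?thesis by (cases ws) auto
  next
    case (Cons a us')
    obtain x y zs where "us @ v # w # ws = a # x # y # zs"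
      using Cons by (cases us'; cases "tl us'") auto
    moreover obtain x y zs where "us @ w # v # ws = a # x # y # zs"
      using Cons by (cases us'; cases "tl us'") auto
    ultimately show ?thesis by simp
  qed
qed

lemma wedge3_in_oriented_chains:
  assumes "\<And>x y z. wedge3 f g h [x, y, z] \<noteq> 0 \<Longrightarrow> {x, y, z} \<in> K"
  shows "wedge3 f g h \<in> oriented_chains K 3"
proof (rule oriented_chainsI)
  fix xs assume nz: "wedge3 f g h xs \<noteq> 0"
  then obtain x y z where "xs = [x, y, z]" "distinct [x, y, z]" using wedge3_support by blast
  then show "length xs = 3 \<and> distinct xs \<and> set xs \<in> K" using assms[of x y z] nz by simp
next
  fix us ws :: "'a list" and v w :: 'a
  consider "us = []" "ws = []" | a where "us = [a]" "ws = []" | a where "us = []" "ws = [a]"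
    | "length us + length ws \<ge> 2"
    by (cases us; cases ws; cases "tl us"; cases "tl ws") auto
  then show "wedge3 f g h (us @ v # w # ws) = - wedge3 f g h (us @ w # v # ws)"
  proof cases
    case 4
    have "wedge3 f g h xs = 0" if "length xs \<ge> 4" for xs
    proof (rule ccontr)
      assume "wedge3 f g h xs \<noteq> 0"
      from wedge3_support[OF this] that show False by auto
    qed
    then show ?thesis using 4 by simp
  qed (auto simp: algebra_simps)
qed

lemma boundary_wedge2:
  assumes "(\<Sum>v\<in>\<Union>K. f v) = F" "(\<Sum>v\<in>\<Union>K. g v) = G"
  shows "boundary K (wedge2 f g) [y] = F * g y - G * f y"
  by (simp add: boundary_def sum_subtractf assms(1,2)[symmetric] sum_distrib_left sum_distrib_right mult.commute)

text \<open>Summing over the first vertex of the determinant replaces a function by its total.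
  Totals 1 give the boundary of a triangle; totals 0 give a cycle at once, as for octahedra.\<close>

lemma boundary_wedge3:
  assumes "(\<Sum>v\<in>\<Union>K. f v) = F" "(\<Sum>v\<in>\<Union>K. g v) = G" "(\<Sum>v\<in>\<Union>K. h v) = H"
  shows "boundary K (wedge3 f g h) =
    chain_scale F (wedge2 g h) - chain_scale G (wedge2 f h) + chain_scale H (wedge2 f g)"
  by (simp add: fun_eq_iff boundary_def sum_subtractf sum.distrib
      assms(1-3)[symmetric] sum_distrib_right)

lemma sum_ind:
  assumes "finite A" "a \<in> A"
  shows "(\<Sum>v\<in>A. ind a v) = (1 :: 'k::field)"
  using assms by (simp add: ind_def)

section \<open>Contraction with a vertex\<close>

text \<open>Interior product with \<open>v\<close>: it extracts the part of a chain that lies in the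
  link of \<open>v\<close>.\<close>

definition contract :: "'a \<Rightarrow> ('a list \<Rightarrow> 'k::field) \<Rightarrow> 'a list \<Rightarrow> 'k" where
  "contract v c xs = c (v # xs)"

lemma contract_add: "contract v (c + c') = contract v c + contract v c'"
  by (simp add: contract_def fun_eq_iff)

lemma contract_scale: "contract v (chain_scale r c) = chain_scale r (contract v c)"
  by (simp add: contract_def fun_eq_iff)

text \<open>The sign comes from exchanging \<open>v\<close> with the vertex that is summed
  over.\<close>

lemma boundary_contract:
  assumes "c \<in> oriented_chains K k"
  shows "boundary K' (contract v c) = - contract v (boundary K' c)"
proof
  fix ys
  have "c (v # w # ys) = - c (w # v # ys)" for w
    using oriented_chains_swap[OF assms, of "[]" v w ys] by simp
  then show "boundary K' (contract v c) ys = (- contract v (boundary K' c)) ys"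
    by (simp add: boundary_def contract_def sum_negf)
qed

lemma contract_in_oriented_chains:
  assumes "c \<in> oriented_chains K (Suc k)"
    and "\<And>\<sigma>. insert v \<sigma> \<in> K \<Longrightarrow> v \<notin> \<sigma> \<Longrightarrow> \<sigma> \<in> L"
  shows "contract v c \<in> oriented_chains L k"
proof (rule oriented_chainsI)
  fix xs assume "contract v c xs \<noteq> 0"
  then show "length xs = k \<and> distinct xs \<and> set xs \<in> L"
    using oriented_chains_support[OF assms(1), of "v # xs"] assms(2) by (auto simp: contract_def)
next
  fix us x w ws
  show "contract v c (us @ x # w # ws) = - contract v c (us @ w # x # ws)"
    using oriented_chains_swap[OF assms(1), of "v # us" x w ws] by (simp add: contract_def)
qed

text \<open>Adjacent transpositions carry an occurrence of \<open>v\<close> to the front, where the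
  coefficient is one of \<open>contract v c\<close>.\<close>

lemma contract_eq_0_support:
  assumes "c \<in> oriented_chains K k" "contract v c = 0" "c xs \<noteq> 0"
  shows "v \<notin> set xs"
proof
  have "c (us @ v # ws) = 0" for us ws
  proof (induction us arbitrary: ws rule: rev_induct)
    case Nil
    then show ?case using assms(2) by (simp add: contract_def fun_eq_iff)
  next
    case (snoc a us)
    have "c (us @ a # v # ws) = - c (us @ v # a # ws)" by (rule oriented_chains_swap[OF assms(1)])
    then show ?case using snoc[of "a # ws"] by simp
  qed
  moreover assume "v \<in> set xs"
  ultimately show False using assms(3) by (metis split_list)
qed

text \<open>The cone over \<open>c\<close> with apex \<open>v\<close>, a right inverse of
  \<open>contract v\<close>: the first \<open>v\<close> is deleted from the list, at the price of
  one sign for each vertex standing before it.\<close>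

fun cone_chain :: "'a \<Rightarrow> ('a list \<Rightarrow> 'k::field) \<Rightarrow> 'a list \<Rightarrow> 'k" where
  "cone_chain v c [] = 0"
| "cone_chain v c (x # xs) = (if x = v then c xs else - cone_chain v (contract x c) xs)"

lemma contract_cone: "contract v (cone_chain v c) = c"
  by (simp add: contract_def fun_eq_iff)

lemma cone_uminus: "cone_chain v (\<lambda>ys. - c ys) xs = - cone_chain v c xs"
proof (induction xs arbitrary: c)
  case (Cons x xs)
  have "contract x (\<lambda>ys. - c ys) = (\<lambda>ys. - contract x c ys)" by (simp add: contract_def fun_eq_iff)
  then show ?case using Cons[of "contract x c"] by simp
qed simp

lemma cone_support:
  "cone_chain v c xs \<noteq> 0 \<Longrightarrow> \<exists>us ws. xs = us @ v # ws \<and> c (us @ ws) \<noteq> 0"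
proof (induction xs arbitrary: c)
  case (Cons x xs)
  show ?case
  proof (cases "x = v")
    case True
    then show ?thesis using Cons.prems by (intro exI[of _ "[]"] exI[of _ xs]) auto
  next
    case False
    then obtain us ws where "xs = us @ v # ws" "contract x c (us @ ws) \<noteq> 0"
      using Cons.prems Cons.IH[of "contract x c"] by auto
    then show ?thesis by (intro exI[of _ "x # us"] exI[of _ ws]) (auto simp: contract_def)
  qed
qed simp

text \<open>The delicate case is that both exchanged entries equal \<open>v\<close>: the value is
  then, up to sign, one of \<open>c\<close> on a list through \<open>v\<close>, and the second
  assumption makes it 0.\<close>

lemma cone_swap:
  assumes "\<And>us a b ws. c (us @ a # b # ws) = - c (us @ b # a # ws)"
    and "\<And>xs. v \<in> set xs \<Longrightarrow> c xs = 0"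
  shows "cone_chain v c (us @ a # b # ws) = - cone_chain v c (us @ b # a # ws)"
  using assms
proof (induction us arbitrary: c)
  case Nil
  have "contract b (contract a c) = (\<lambda>ys. - contract a (contract b c) ys)"
    using Nil(1)[of "[]" a b] by (auto simp: contract_def fun_eq_iff)
  then have "cone_chain v (contract b (contract a c)) ws = - cone_chain v (contract a (contract b c)) ws"
    by (simp only: cone_uminus)
  then show ?case using Nil(2)[of "v # ws"] by (auto simp: contract_def)
next
  case (Cons x us)
  have "cone_chain v (contract x c) (us @ a # b # ws) = - cone_chain v (contract x c) (us @ b # a # ws)"
  proof (rule Cons.IH)
    show "contract x c (us @ a # b # ws) = - contract x c (us @ b # a # ws)" for us a b ws
      unfolding contract_def using Cons.prems(1)[of "x # us" a b ws] by (simp only: append_Cons)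
    show "contract x c xs = 0" if "v \<in> set xs" for xs
      using Cons.prems(2)[of "x # xs"] that by (simp add: contract_def)
  qed
  moreover have "c (us @ a # b # ws) = - c (us @ b # a # ws)" by (rule Cons.prems(1))
  ultimately show ?case by simp
qed

lemma cone_in_oriented_chains:
  assumes "c \<in> oriented_chains L k"
    and "\<And>\<sigma>. \<sigma> \<in> L \<Longrightarrow> v \<notin> \<sigma> \<and> insert v \<sigma> \<in> K"
  shows "cone_chain v c \<in> oriented_chains K (Suc k)"
proof (rule oriented_chainsI)
  fix xs assume "cone_chain v c xs \<noteq> 0"
  from cone_support[OF this] obtain us ws where xs: "xs = us @ v # ws" and nz: "c (us @ ws) \<noteq> 0"
    by blast
  then show "length xs = Suc k \<and> distinct xs \<and> set xs \<in> K"
    using oriented_chains_support[OF assms(1) nz] assms(2)[of "set (us @ ws)"] by auto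
next
  fix us a b ws
  show "cone_chain v c (us @ a # b # ws) = - cone_chain v c (us @ b # a # ws)"
  proof (rule cone_swap)
    show "c (us @ a # b # ws) = - c (us @ b # a # ws)" for us a b ws
      by (rule oriented_chains_swap[OF assms(1)])
    show "c xs = 0" if "v \<in> set xs" for xs
      using that oriented_chains_support[OF assms(1), of xs] assms(2) by blast
  qed
qed

section \<open>Families of induced matchings\<close>

text \<open>One non-edge per ordered pair suffices: exchanging the two edges yields the other one,
  and a shared end point would make \<open>(u, v')\<close> itself one of the two edges of
  \<open>M\<close>.\<close>

lemma induced_matchingI:
  assumes "M \<subseteq> E"
    and "\<And>u v u' v'. (u, v) \<in> M \<Longrightarrow> (u', v') \<in> M \<Longrightarrow> (u, v) \<noteq> (u', v') \<Longrightarrow> (u, v') \<notin> E"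
  shows "induced_matching E M"
proof -
  have "u \<noteq> u' \<and> v \<noteq> v' \<and> (u, v') \<notin> E \<and> (u', v) \<notin> E"
    if "(u, v) \<in> M" "(u', v') \<in> M" "(u, v) \<noteq> (u', v')" for u v u' v'
  proof -
    have "(u, v') \<notin> E" "(u', v) \<notin> E" using assms(2) that by metis+
    then show ?thesis using that assms(1) by auto
  qed
  then show ?thesis unfolding induced_matching_def matching_def using assms(1) by fastforce
qed

lemma induced_matchingD:
  assumes "induced_matching E M"
  shows "M \<subseteq> E" "(u, v) \<in> M \<Longrightarrow> (u', v') \<in> M \<Longrightarrow> (u, v) \<noteq> (u', v') \<Longrightarrow> (u, v') \<notin> E"
proof -
  show "M \<subseteq> E" using assms unfolding induced_matching_def matching_def by simp
  have "\<forall>x\<in>M. \<forall>y\<in>M. x \<noteq> y \<longrightarrow> (fst x, snd y) \<notin> E"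
    using assms unfolding induced_matching_def split_beta by simp
  then show "(u, v') \<notin> E" if "(u, v) \<in> M" "(u', v') \<in> M" "(u, v) \<noteq> (u', v')"
    using that by fastforce
qed

lemma induced_matching_subset:
  assumes "induced_matching E M" "M' \<subseteq> M" "M' \<subseteq> E'" "E' \<subseteq> E"
  shows "induced_matching E' M'"
proof (rule induced_matchingI[OF assms(3)])
  fix u v u' v' assume "(u, v) \<in> M'" "(u', v') \<in> M'" "(u, v) \<noteq> (u', v')"
  then have "(u, v') \<notin> E" using assms(2) by (intro induced_matchingD(2)[OF assms(1), of u v u' v']) auto
  then show "(u, v') \<notin> E'" using assms(4) by blast
qed

definition matching_sums :: "nat \<Rightarrow> nat set" where
  "matching_sums n = {\<Sum>i = 1..t. card (M i) | (U :: nat set) V E t M.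
            finite U \<and> finite V \<and> card U \<le> n \<and> card V \<le> n \<and> bipartite_graph U V E \<and>
            t \<le> n \<and> (\<forall>i\<in>{1..t}. induced_matching E (M i)) \<and> disjoint_family_on M {1..t}}"

lemma max_induced_matchings_eq: "max_induced_matchings n = Max (matching_sums n)"
  by (simp add: max_induced_matchings_def matching_sums_def)

text \<open>At most \<open>n\<close> matchings with at most \<open>n * n\<close> edges each;
  finiteness makes the \<open>Max\<close> a true maximum.\<close>

lemma finite_matching_sums: "finite (matching_sums n)"
proof -
  have "x \<le> n * (n * n)" if x: "x \<in> matching_sums n" for x
  proof -
    obtain U V :: "nat set" and E t M where *: "x = (\<Sum>i = 1..t. card (M i))" "finite U" "finite V" "card U \<le> n"
      "card V \<le> n" "bipartite_graph U V E" "t \<le> n" "\<forall>i\<in>{1..t}. induced_matching E (M i)"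
      using x unfolding matching_sums_def by blast
    have "card (M i) \<le> n * n" if "i \<in> {1..t}" for i
    proof -
      have "M i \<subseteq> U \<times> V" using induced_matchingD(1) * that unfolding bipartite_graph_def by blast
      then have "card (M i) \<le> card (U \<times> V)" using * by (intro card_mono) auto
      also have "\<dots> \<le> n * n" using * by (simp add: card_cartesian_product mult_le_mono)
      finally show ?thesis .
    qed
    then have "x \<le> (\<Sum>i = 1..t. n * n)" unfolding *(1) by (rule sum_mono)
    also have "\<dots> \<le> n * (n * n)" using *(7) by simp
    finally show ?thesis .
  qed
  then have "matching_sums n \<subseteq> {..n * (n * n)}" by (intro subsetI) simp
  then show ?thesis by (rule finite_subset) simp
qed

lemma matching_sums_nonempty: "matching_sums n \<noteq> {}"
proof -
  have "(\<Sum>i = 1..0. card ((\<lambda>_. {}) i)) \<in> matching_sums n"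
    unfolding matching_sums_def
    by (intro CollectI exI[of _ "{}"] exI[of _ "0::nat"] exI[of _ "\<lambda>_. {}"] conjI refl)
       (auto simp: bipartite_graph_def disjoint_family_on_def)
  then show ?thesis by blast
qed

text \<open>The form in which \<open>max_induced_matchings\<close> is bounded from below: the sides
  may overlap and have any vertex type, and the index set is arbitrary. Copying the sides to even
  and odd numbers makes them disjoint.\<close>

lemma sum_induced_matchings_le:
  fixes U V :: "'a set" and M :: "'j \<Rightarrow> ('a \<times> 'a) set"
  assumes "finite U" "finite V" "card U \<le> n" "card V \<le> n" "E \<subseteq> U \<times> V"
    and "finite J" "card J \<le> n" "\<And>j. j \<in> J \<Longrightarrow> induced_matching E (M j)" "disjoint_family_on M J"
  shows "(\<Sum>j\<in>J. card (M j)) \<le> max_induced_matchings n"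
proof -
  obtain f :: "'a \<Rightarrow> nat" where f: "inj_on f U" using finite_imp_inj_to_nat_seg[OF assms(1)] by auto
  obtain g :: "'a \<Rightarrow> nat" where g: "inj_on g V" using finite_imp_inj_to_nat_seg[OF assms(2)] by auto
  define F where "F = (\<lambda>(u, v). (2 * f u, 2 * g v + 1))"
  have F: "inj_on F (U \<times> V)" using f g by (auto simp: inj_on_def F_def)
  obtain h where h: "bij_betw h {1..card J} J"
    using ex_bij_betw_nat_finite_1[OF assms(6)] by blast
  have MUV: "M j \<subseteq> U \<times> V" if "j \<in> J" for j
    using induced_matchingD(1)[OF assms(8)[OF that]] assms(5) by blast
  have hJ: "h i \<in> J" if "i \<in> {1..card J}" for i using h that by (auto simp: bij_betw_def)
  have im: "induced_matching (F ` E) (F ` M (h i))" if "i \<in> {1..card J}" for i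
  proof (rule induced_matchingI)
    note m = induced_matchingD[OF assms(8)[OF hJ[OF that]]]
    show "F ` M (h i) \<subseteq> F ` E" using m(1) by blast
    fix a b a' b' assume "(a, b) \<in> F ` M (h i)" "(a', b') \<in> F ` M (h i)" "(a, b) \<noteq> (a', b')"
    then obtain u v u' v' where *: "(u, v) \<in> M (h i)" "(u', v') \<in> M (h i)" "(u, v) \<noteq> (u', v')"
      "(a, b) = F (u, v)" "(a', b') = F (u', v')" by (auto simp: F_def)
    then have "(u, v') \<notin> E" using m(2) by blast
    moreover have "(u, v') \<in> U \<times> V" using * MUV[OF hJ[OF that]] by blast
    ultimately have "F (u, v') \<notin> F ` E" using F assms(5) by (meson inj_on_image_mem_iff)
    then show "(a, b') \<notin> F ` E" using * by (simp add: F_def)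
  qed
  have disj: "disjoint_family_on (\<lambda>i. F ` M (h i)) {1..card J}"
    unfolding disjoint_family_on_def
  proof (intro ballI impI)
    fix i i' assume i: "i \<in> {1..card J}" "i' \<in> {1..card J}" "i \<noteq> i'"
    then have "h i \<noteq> h i'" using bij_betw_imp_inj_on[OF h] by (meson inj_onD)
    then have "M (h i) \<inter> M (h i') = {}"
      using disjoint_family_onD[OF assms(9) hJ[OF i(1)] hJ[OF i(2)]] by simp
    then show "F ` M (h i) \<inter> F ` M (h i') = {}"
      using inj_on_image_Int[OF F MUV[OF hJ[OF i(1)]] MUV[OF hJ[OF i(2)]]] by simp
  qed
  have "(\<Sum>j\<in>J. card (M j)) = (\<Sum>i = 1..card J. card (M (h i)))"
    by (rule sum.reindex_bij_betw[OF h, symmetric])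
  also have "\<dots> = (\<Sum>i = 1..card J. card (F ` M (h i)))"
    using inj_on_subset[OF F MUV[OF hJ]] by (intro sum.cong refl) (simp add: card_image)
  also have "\<dots> \<in> matching_sums n"
    unfolding matching_sums_def
  proof (intro CollectI exI conjI refl ballI)
    show "finite ((\<lambda>u. 2 * f u) ` U)" "finite ((\<lambda>v. 2 * g v + 1) ` V)" using assms by auto
    show "card ((\<lambda>u. 2 * f u) ` U) \<le> n" using assms(1,3) card_image_le le_trans by blast
    show "card ((\<lambda>v. 2 * g v + 1) ` V) \<le> n" using assms(2,4) card_image_le le_trans by blast
    show "bipartite_graph ((\<lambda>u. 2 * f u) ` U) ((\<lambda>v. 2 * g v + 1) ` V) (F ` E)"
      using assms(5) by (auto simp: bipartite_graph_def F_def) presburger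
  qed (use assms(7) im disj in auto)
  finally show ?thesis unfolding max_induced_matchings_eq using finite_matching_sums by simp
qed

lemma max_induced_matchings_attained:
  obtains U V :: "nat set" and E t M where
    "finite U" "finite V" "card U \<le> n" "card V \<le> n" "E \<subseteq> U \<times> V" "t \<le> n"
    "\<And>i. i \<in> {1..t} \<Longrightarrow> induced_matching E (M i)" "disjoint_family_on M {1..t}"
    "max_induced_matchings n = (\<Sum>i = 1..t. card (M i))"
proof -
  have "max_induced_matchings n \<in> matching_sums n"
    unfolding max_induced_matchings_eq using finite_matching_sums matching_sums_nonempty by (rule Max_in)
  then show ?thesis using that unfolding matching_sums_def bipartite_graph_def by blast
qed

text \<open>Take \<open>n div 3\<close> disjoint copies of the complete bipartite graph on 3 + 3
  vertices. For each of the nine pairs \<open>(r, s)\<close> the edges from vertex \<open>r\<close>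
  to vertex \<open>s\<close> in all copies form an induced matching; \<open>n \<ge> 9\<close> leaves
  room for nine matchings. The surplus over \<open>n\<close> later absorbs the loss of one edge per
  matching.\<close>

lemma max_induced_matchings_ge:
  assumes "n \<ge> 9"
  shows "2 * n \<le> max_induced_matchings n"
proof -
  define q where "q = n div 3"
  define E where "E = {(a, b) \<in> {..<3 * q} \<times> {..<3 * q}. a div 3 = b div 3}"
  define M where "M = (\<lambda>(r, s). (\<lambda>c. (3 * c + r, 3 * c + s)) ` {..<q})"
  define J where "J = {..<3::nat} \<times> {..<3::nat}"
  have card: "card (M j) = q" for j
    by (cases j) (auto simp: M_def card_image inj_on_def)
  have "(\<Sum>j\<in>J. card (M j)) \<le> max_induced_matchings n"
  proof (rule sum_induced_matchings_le[where U = "{..<3 * q}" and V = "{..<3 * q}" and E = E])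
    fix j assume "j \<in> J"
    then obtain r s where j: "j = (r, s)" "r < 3" "s < 3" by (auto simp: J_def)
    show "induced_matching E (M j)"
      by (rule induced_matchingI) (use j in \<open>auto simp: E_def M_def\<close>)
  next
    have "j = (fst x mod 3, snd x mod 3)" if "x \<in> M j" "j \<in> J" for x j
      using that by (auto simp: M_def J_def)
    then show "disjoint_family_on M J" unfolding disjoint_family_on_def by blast
  qed (use assms in \<open>auto simp: q_def E_def J_def\<close>)
  then have "9 * q \<le> max_induced_matchings n" by (simp add: card J_def)
  moreover have "2 * n \<le> 9 * q" using assms unfolding q_def by presburger
  ultimately show ?thesis by linarith
qed

lemma ex_balanced_partition:
  assumes "finite A" "card A \<le> 4 * m"
  shows "\<exists>f :: 'a \<Rightarrow> nat. f ` A \<subseteq> {..<4} \<and> (\<forall>i. card {a \<in> A. f a = i} \<le> m)"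
proof -
  obtain g where g: "bij_betw g A {..<card A}"
    using ex_bij_betw_finite_nat[OF assms(1)] by (auto simp: atLeast0LessThan)
  define f where "f a = g a div m" for a
  have "f a < 4" if "a \<in> A" for a
  proof -
    have "g a < card A" using g that by (auto simp: bij_betw_def)
    then have "g a < 4 * m" using assms(2) by linarith
    then show ?thesis unfolding f_def by (rule less_mult_imp_div_less)
  qed
  then have "f ` A \<subseteq> {..<4}" by auto
  moreover have "card {a \<in> A. f a = i} \<le> m" for i
  proof (cases "m = 0")
    case True
    then show ?thesis using assms by simp
  next
    case False
    have "card {a \<in> A. f a = i} \<le> card {i * m..<i * m + m}"
    proof (rule card_inj_on_le)
      show "inj_on g {a \<in> A. f a = i}"
        by (rule inj_on_subset[OF bij_betw_imp_inj_on[OF g]]) auto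
      have "i * m \<le> x \<and> x < i * m + m" if "x div m = i" for x
        using that False div_times_less_eq_dividend[of x m] dividend_less_div_times[of m x] by auto
      then show "g ` {a \<in> A. f a = i} \<subseteq> {i * m..<i * m + m}" by (auto simp: f_def)
    qed simp
    then show ?thesis by simp
  qed
  ultimately show ?thesis by blast
qed

text \<open>Split \<open>U\<close>, \<open>V\<close> and the index set into four parts each. Every
  matching edge belongs to exactly one of the 64 triples of parts, and each triple is a family of
  size parameter \<open>m\<close>. The lower bound needs this since its clusters have only about a
  quarter of the points each.\<close>

lemma max_induced_matchings_quarter:
  assumes "n \<le> 4 * m"
  shows "max_induced_matchings n \<le> 64 * max_induced_matchings m"
proof -
  obtain U V :: "nat set" and E t M where *:
    "finite U" "finite V" "card U \<le> n" "card V \<le> n" "E \<subseteq> U \<times> V" "t \<le> n"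
    "\<And>i. i \<in> {1..t} \<Longrightarrow> induced_matching E (M i)" "disjoint_family_on M {1..t}"
    and max: "max_induced_matchings n = (\<Sum>i = 1..t. card (M i))"
    using max_induced_matchings_attained by blast
  obtain f :: "nat \<Rightarrow> nat" where f: "f ` U \<subseteq> {..<4}" "\<And>i. card {a \<in> U. f a = i} \<le> m"
    using ex_balanced_partition[OF *(1) le_trans[OF *(3) assms]] by blast
  obtain g :: "nat \<Rightarrow> nat" where g: "g ` V \<subseteq> {..<4}" "\<And>i. card {a \<in> V. g a = i} \<le> m"
    using ex_balanced_partition[OF *(2) le_trans[OF *(4) assms]] by blast
  have "card {1..t} \<le> 4 * m" using *(6) assms by simp
  then obtain h :: "nat \<Rightarrow> nat" where h: "h ` {1..t} \<subseteq> {..<4}" "\<And>i. card {a \<in> {1..t}. h a = i} \<le> m"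
    using ex_balanced_partition[of "{1..t}" m] by blast
  define M' where "M' a b i = {(u, v) \<in> M i. f u = a \<and> g v = b}" for a b i
  have MUV: "M i \<subseteq> U \<times> V" if "i \<in> {1..t}" for i
    using induced_matchingD(1)[OF *(7)[OF that]] *(5) by blast
  have part: "card (M i) = (\<Sum>a<4. \<Sum>b<4. card (M' a b i))" if i: "i \<in> {1..t}" for i
  proof -
    have fin: "finite (M i)" using MUV[OF i] *(1,2) by (meson finite_SigmaI finite_subset)
    have "M i = (\<Union>p\<in>{..<4} \<times> {..<4}. M' (fst p) (snd p) i)"
      using MUV[OF i] f(1) g(1) by (force simp: M'_def)
    then have "card (M i) = card (\<Union>p\<in>{..<4} \<times> {..<4}. M' (fst p) (snd p) i)" by simp
    also have "\<dots> = (\<Sum>p\<in>{..<4} \<times> {..<4}. card (M' (fst p) (snd p) i))"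
      using fin by (intro card_UN_disjoint) (auto simp: M'_def intro: finite_subset)
    also have "\<dots> = (\<Sum>a<4. \<Sum>b<4. card (M' a b i))"
      by (simp add: sum.cartesian_product case_prod_unfold)
    finally show ?thesis .
  qed
  have small: "(\<Sum>i\<in>{i \<in> {1..t}. h i = c}. card (M' a b i)) \<le> max_induced_matchings m" for a b c
  proof (rule sum_induced_matchings_le)
    let ?U = "{u \<in> U. f u = a}" and ?V = "{v \<in> V. g v = b}"
    show "finite ?U" "finite ?V" "card ?U \<le> m" "card ?V \<le> m" using * f g by auto
    show "E \<inter> ?U \<times> ?V \<subseteq> ?U \<times> ?V" by simp
    show "card {i \<in> {1..t}. h i = c} \<le> m" by (rule h(2))
    show "induced_matching (E \<inter> ?U \<times> ?V) (M' a b i)" if "i \<in> {i \<in> {1..t}. h i = c}" for i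
    proof (rule induced_matching_subset[of E "M i"])
      have i: "i \<in> {1..t}" using that by simp
      show "induced_matching E (M i)" using *(7)[OF i] .
      show "M' a b i \<subseteq> E \<inter> ?U \<times> ?V"
        using MUV[OF i] induced_matchingD(1)[OF *(7)[OF i]] by (auto simp: M'_def)
    qed (auto simp: M'_def)
    show "disjoint_family_on (M' a b) {i \<in> {1..t}. h i = c}"
      using *(8) unfolding disjoint_family_on_def M'_def by blast
  qed simp
  have "max_induced_matchings n = (\<Sum>i = 1..t. \<Sum>a<4. \<Sum>b<4. card (M' a b i))"
    unfolding max by (rule sum.cong[OF refl part])
  also have "\<dots> = (\<Sum>c<4. \<Sum>i\<in>{i \<in> {1..t}. h i = c}. \<Sum>a<4. \<Sum>b<4. card (M' a b i))"
    by (rule sum.group[symmetric]) (use h(1) in auto)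
  also have "\<dots> = (\<Sum>c<4. \<Sum>a<4. \<Sum>b<4. \<Sum>i\<in>{i \<in> {1..t}. h i = c}. card (M' a b i))"
  proof (rule sum.cong[OF refl])
    fix c
    have "(\<Sum>i\<in>{i \<in> {1..t}. h i = c}. \<Sum>a<4. \<Sum>b<4. card (M' a b i)) =
        (\<Sum>a<4. \<Sum>i\<in>{i \<in> {1..t}. h i = c}. \<Sum>b<4. card (M' a b i))"
      by (rule sum.swap)
    also have "\<dots> = (\<Sum>a<4. \<Sum>b<4. \<Sum>i\<in>{i \<in> {1..t}. h i = c}. card (M' a b i))"
      by (rule sum.cong[OF refl sum.swap])
    finally show "(\<Sum>i\<in>{i \<in> {1..t}. h i = c}. \<Sum>a<4. \<Sum>b<4. card (M' a b i)) =
        (\<Sum>a<4. \<Sum>b<4. \<Sum>i\<in>{i \<in> {1..t}. h i = c}. card (M' a b i))" .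
  qed
  also have "\<dots> \<le> (\<Sum>c<4::nat. \<Sum>a<4::nat. \<Sum>b<4::nat. max_induced_matchings m)"
    by (intro sum_mono small)
  also have "\<dots> = 64 * max_induced_matchings m" by simp
  finally show ?thesis .
qed

section \<open>Complexes coloured by local cliques\<close>

text \<open>Abstracts from the geometry: by \<open>clique\<close>, each colour class meets the
  neighbourhood of any vertex in a clique, and \<open>idx\<close> fixes the order in which vertices
  are removed. Of \<alpha> and the dimension only \<open>card P\<close> remains.\<close>

locale clique_coloured_complex =
  fixes S :: "'a set" and K :: "'a set set" and \<kappa> :: "'a \<Rightarrow> 'c" and P :: "'c set" and idx :: "'a \<Rightarrow> nat"
  assumes finite_S: "finite S" and flag: "flag_complex S K"
    and finite_P: "finite P" and colours: "\<kappa> ` S \<subseteq> P"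
    and clique: "\<And>v a b. {a, v} \<in> K \<Longrightarrow> {b, v} \<in> K \<Longrightarrow> \<kappa> a = \<kappa> b \<Longrightarrow> {a, b} \<in> K"
    and idx: "bij_betw idx S {..<card S}"
begin

lemma complex: "simplicial_complex S K"
  using flag by (simp add: flag_complex_def)

lemma face_subset: "\<sigma> \<in> K \<Longrightarrow> \<sigma> \<subseteq> S"
  using complex by (auto simp: simplicial_complex_def)

lemma face_mono: "\<sigma> \<in> K \<Longrightarrow> \<tau> \<subseteq> \<sigma> \<Longrightarrow> \<tau> \<in> K"
  using complex by (auto simp: simplicial_complex_def)

lemma Union_K: "\<Union>K = S"
  using complex by (auto simp: simplicial_complex_def)

lemma faceI:
  assumes "finite \<sigma>" "\<And>a b. a \<in> \<sigma> \<Longrightarrow> b \<in> \<sigma> \<Longrightarrow> {a, b} \<in> K"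
  shows "\<sigma> \<in> K"
proof -
  have "e \<in> K" if "e \<subseteq> \<sigma>" "card e = 2" for e
    using that assms(2) by (auto simp: card_2_iff)
  moreover have "\<sigma> \<subseteq> S" using assms(2) face_subset by blast
  ultimately show ?thesis using flag assms(1) unfolding flag_complex_def by blast
qed

lemma idx_inj: "a \<in> S \<Longrightarrow> b \<in> S \<Longrightarrow> idx a = idx b \<Longrightarrow> a = b"
  using idx by (auto simp: bij_betw_def inj_on_def)

section \<open>Links and initial parts in the vertex order\<close>

definition earlier_nbrs :: "'a \<Rightarrow> 'a set" where
  "earlier_nbrs v = {a. {a, v} \<in> K \<and> idx a < idx v}"

text \<open>The link of \<open>v\<close> in the complex on \<open>v\<close> and the vertices before
  it; the index condition also keeps \<open>v\<close> out of \<open>\<sigma>\<close>.\<close>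

definition earlier_link :: "'a \<Rightarrow> 'a set set" where
  "earlier_link v = {\<sigma>. insert v \<sigma> \<in> K \<and> (\<forall>a\<in>\<sigma>. idx a < idx v)}"

definition initial_complex :: "nat \<Rightarrow> 'a set set" where
  "initial_complex s = {\<sigma> \<in> K. \<forall>a\<in>\<sigma>. idx a < s}"

lemma earlier_nbrs_subset: "earlier_nbrs v \<subseteq> S"
  using face_subset by (auto simp: earlier_nbrs_def)

lemma finite_earlier_nbrs: "finite (earlier_nbrs v)"
  using earlier_nbrs_subset finite_S by (rule finite_subset)

lemma earlier_nbrs_clique:
  "a \<in> earlier_nbrs v \<Longrightarrow> b \<in> earlier_nbrs v \<Longrightarrow> \<kappa> a = \<kappa> b \<Longrightarrow> {a, b} \<in> K"
  using clique by (auto simp: earlier_nbrs_def)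

lemma earlier_linkI:
  assumes "finite \<sigma>" "\<sigma> \<subseteq> earlier_nbrs v" "\<sigma> \<noteq> {}" "\<And>a b. a \<in> \<sigma> \<Longrightarrow> b \<in> \<sigma> \<Longrightarrow> {a, b} \<in> K"
  shows "\<sigma> \<in> earlier_link v"
proof -
  have nb: "{a, v} \<in> K" "idx a < idx v" if "a \<in> \<sigma>" for a
    using that assms(2) by (auto simp: earlier_nbrs_def)
  \<comment> \<open>Here \<open>\<sigma> \<noteq> {}\<close> enters: a neighbour certifies that
    \<open>v\<close> is a vertex of \<open>K\<close>.\<close>
  have "{v} \<in> K" using nb(1) assms(3) face_mono by blast
  then have "{x, y} \<in> K" if "x \<in> insert v \<sigma>" "y \<in> insert v \<sigma>" for x y
    using that assms(4) nb(1) by (metis insertE insert_absorb2 insert_commute)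
  then have "insert v \<sigma> \<in> K"
    by (rule faceI[rotated]) (use assms(1) in auto)
  then show ?thesis using nb by (simp add: earlier_link_def)
qed

lemma earlier_link_triangleI:
  assumes "a \<in> earlier_nbrs v" "b \<in> earlier_nbrs v" "c \<in> earlier_nbrs v"
    and "{a, b} \<in> K" "{a, c} \<in> K" "{b, c} \<in> K"
  shows "{a, b, c} \<in> earlier_link v"
proof (rule earlier_linkI)
  have "{a} \<in> K" "{b} \<in> K" "{c} \<in> K" using assms(4,6) face_mono by blast+
  then show "\<And>x y. x \<in> {a, b, c} \<Longrightarrow> y \<in> {a, b, c} \<Longrightarrow> {x, y} \<in> K"
    using assms by (auto simp: insert_commute)
qed (use assms in auto)

lemma earlier_link_subset: "\<sigma> \<in> earlier_link v \<Longrightarrow> \<sigma> \<subseteq> earlier_nbrs v"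
  using face_mono[of "insert v \<sigma>" "{_, v}"] by (auto simp: earlier_link_def earlier_nbrs_def)

lemma earlier_link_K: "\<sigma> \<in> earlier_link v \<Longrightarrow> \<sigma> \<in> K"
  using face_mono by (auto simp: earlier_link_def)

text \<open>
  An edge \<open>(a, b)\<close> of the link of \<open>v\<close> is new if no earlier vertex of the colour of \<open>v\<close> spans a triangle
  with it, except that vertices up to \<open>b\<close> are allowed when \<open>b\<close> itself has the colour of \<open>v\<close>. In
  both cases the edge and the colour of \<open>v\<close> determine \<open>v\<close>.
\<close>

definition new_edges :: "'a \<Rightarrow> 'c \<Rightarrow> 'c \<Rightarrow> ('a \<times> 'a) set" where
  "new_edges v i j = {(a, b). a \<in> earlier_nbrs v \<and> b \<in> earlier_nbrs v \<and> {a, b} \<in> K \<and>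
     \<kappa> a = i \<and> \<kappa> b = j \<and> i \<noteq> j \<and>
     (\<forall>w\<in>earlier_nbrs v. \<kappa> w = \<kappa> v \<and> {a, w} \<in> K \<and> {b, w} \<in> K \<longrightarrow> \<kappa> b = \<kappa> v \<and> idx w \<le> idx b)}"

lemma finite_new_edges: "finite (new_edges v i j)"
  by (rule finite_subset[of _ "earlier_nbrs v \<times> earlier_nbrs v"]) (auto simp: new_edges_def finite_earlier_nbrs)

text \<open>Let \<open>v\<close> come before \<open>v'\<close> and suppose that
  \<open>(a, b)\<close> is new for both. Both are neighbours of \<open>a\<close> of the same colour,
  hence adjacent, so \<open>v\<close> is an earlier neighbour of \<open>v'\<close> of its colour
  that spans a triangle with the edge. As \<open>v\<close> comes after \<open>b\<close>, the edge is
  not new for \<open>v'\<close>.\<close>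

lemma new_edges_disjoint:
  assumes "v \<in> S" "v' \<in> S" "\<kappa> v = \<kappa> v'" "v \<noteq> v'"
  shows "new_edges v i j \<inter> new_edges v' i j = {}"
proof -
  have *: False if *: "idx v < idx v'" "\<kappa> v = \<kappa> v'" and "(a, b) \<in> new_edges v i j"
    "(a, b) \<in> new_edges v' i j" for v v' a b
  proof -
    from that have nb: "{a, v} \<in> K" "{b, v} \<in> K" "idx b < idx v" "{a, v'} \<in> K"
      by (auto simp: new_edges_def earlier_nbrs_def)
    then have "{v, v'} \<in> K" using clique[of v a v'] *(2) by (simp add: insert_commute)
    then have "v \<in> earlier_nbrs v'" using * by (simp add: earlier_nbrs_def)
    then show False using that nb by (auto simp: new_edges_def)
  qed
  have "idx v < idx v' \<or> idx v' < idx v" using assms idx_inj by (meson linorder_neqE_nat)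
  then show ?thesis using *[of v v'] *[of v' v] assms(3) by fastforce
qed

text \<open>The host graph must be the same for all removed vertices, so it takes all edges of
  \<open>K\<close> between the two colours and not just those in one link.\<close>

definition colour_edges :: "'c \<Rightarrow> 'c \<Rightarrow> ('a \<times> 'a) set" where
  "colour_edges i j = {(a, b). {a, b} \<in> K \<and> \<kappa> a = i \<and> \<kappa> b = j}"

definition initial_cycles :: "nat \<Rightarrow> ('a list \<Rightarrow> 'k::field) set" where
  "initial_cycles s = {c \<in> oriented_chains (initial_complex s) 3. boundary K c = 0}"

lemma subspace_initial_cycles: "chain_space.subspace (initial_cycles s :: ('a list \<Rightarrow> 'k::field) set)"
proof (rule chain_space.subspaceI)
  show "0 \<in> initial_cycles s"
    using chain_space.subspace_0[OF subspace_oriented_chains]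
    by (auto simp: initial_cycles_def boundary_def fun_eq_iff)
next
  fix x y :: "'a list \<Rightarrow> 'k" assume "x \<in> initial_cycles s" "y \<in> initial_cycles s"
  then show "x + y \<in> initial_cycles s"
    using chain_space.subspace_add[OF subspace_oriented_chains] by (auto simp: initial_cycles_def boundary_add)
next
  fix r and x :: "'a list \<Rightarrow> 'k" assume "x \<in> initial_cycles s"
  then show "chain_scale r x \<in> initial_cycles s"
    using chain_space.subspace_scale[OF subspace_oriented_chains, of x]
    by (auto simp: initial_cycles_def boundary_scale fun_eq_iff)
qed

end

section \<open>One-cycles in the link of a removed vertex\<close>

locale vertex_removal = clique_coloured_complex S K \<kappa> P idx
  for S :: "'a set" and K and \<kappa> :: "'a \<Rightarrow> 'c" and P idx +
  fixes v :: 'a and field_type :: "'k::field itself"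
  assumes v: "v \<in> S"
begin

abbreviation N where "N \<equiv> earlier_nbrs v"

definition base :: "'c \<Rightarrow> 'a" where
  "base i = (SOME a. a \<in> N \<and> \<kappa> a = i)"

lemma base:
  assumes "a \<in> N"
  shows "base (\<kappa> a) \<in> N" "\<kappa> (base (\<kappa> a)) = \<kappa> a"
  using someI[of "\<lambda>b. b \<in> N \<and> \<kappa> b = \<kappa> a" a] assms by (auto simp: base_def)

definition edge :: "'a \<Rightarrow> 'a \<Rightarrow> 'a list \<Rightarrow> 'k" where
  "edge a b = wedge2 (ind a) (ind b)"

definition link_boundaries :: "('a list \<Rightarrow> 'k) set" where
  "link_boundaries = boundary K ` oriented_chains (earlier_link v) 3"

text \<open>The edge from \<open>a\<close> to \<open>b\<close>, prolonged inside the cliques of \<open>a\<close> and \<open>b\<close> to a path between their base points.\<close>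

definition path :: "'a \<times> 'a \<Rightarrow> 'a list \<Rightarrow> 'k" where
  "path = (\<lambda>(a, b). edge (base (\<kappa> a)) a + edge a b - edge (base (\<kappa> b)) b)"

lemma subspace_link_boundaries: "chain_space.subspace link_boundaries"
  unfolding link_boundaries_def by (intro subspace_boundary_image subspace_oriented_chains)

lemma span_link_boundaries: "chain_space.span link_boundaries = link_boundaries"
  using subspace_link_boundaries by (simp add: chain_space.span_eq_iff)

lemma edge_swap: "edge b a = - edge a b"
  by (auto simp: edge_def fun_eq_iff wedge2_def split: list.splits)

lemma path_swap: "path (b, a) = - path (a, b)"
  by (simp add: path_def edge_swap[of b a])

text \<open>Repeated vertices are harmless, as the wedge products then vanish; this covers base
  points that coincide with \<open>a\<close> or \<open>b\<close>.\<close>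

lemma triangle_boundary:
  assumes "{a, b, c} \<in> earlier_link v"
  shows "(edge b c - edge a c + edge a b :: 'a list \<Rightarrow> 'k) \<in> link_boundaries"
proof -
  let ?t = "wedge3 (ind a) (ind b) (ind c) :: 'a list \<Rightarrow> 'k"
  have abc: "a \<in> S" "b \<in> S" "c \<in> S" using earlier_link_subset[OF assms] earlier_nbrs_subset by blast+
  have "?t \<in> oriented_chains (earlier_link v) 3"
  proof (rule wedge3_in_oriented_chains)
    fix x y z assume nz: "?t [x, y, z] \<noteq> 0"
    from wedge3_support[OF this] have d: "distinct [x, y, z]" by auto
    from nz have "{x, y, z} = {a, b, c}"
      using d by (auto simp: ind_def split: if_splits)
    then show "{x, y, z} \<in> earlier_link v" using assms by simp
  qed
  then have "boundary K ?t \<in> link_boundaries" by (auto simp: link_boundaries_def)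
  also have "boundary K ?t = edge b c - edge a c + edge a b"
    using abc finite_S
    by (subst boundary_wedge3[where F = 1 and G = 1 and H = 1]) (auto simp: Union_K sum_ind edge_def)
  finally show ?thesis .
qed

lemma path_same_colour:
  assumes "a \<in> N" "b \<in> N" "\<kappa> a = \<kappa> b"
  shows "path (a, b) \<in> link_boundaries"
proof -
  note p = base[OF assms(1)]
  have "{base (\<kappa> a), a, b} \<in> earlier_link v"
    using assms p by (intro earlier_link_triangleI earlier_nbrs_clique[of _ v]) auto
  from triangle_boundary[OF this] show ?thesis using assms(3) by (simp add: path_def algebra_simps)
qed

text \<open>The legs to the base points cancel, which leaves the boundary of a triangle.\<close>

lemma path_triangle:
  assumes "{a, b, c} \<in> earlier_link v"
  shows "path (a, b) - (path (a, c) + path (c, b)) \<in> link_boundaries"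
proof -
  have "{a, c, b} \<in> earlier_link v" using assms by (simp add: insert_commute)
  from chain_space.subspace_neg[OF subspace_link_boundaries triangle_boundary[OF this]]
  have "- (edge c b - edge a b + edge a c) \<in> link_boundaries" by (simp add: fun_Compl_def)
  moreover have "path (a, b) - (path (a, c) + path (c, b)) = - (edge c b - edge a b + edge a c)"
    by (simp add: path_def algebra_simps)
  ultimately show ?thesis by simp
qed

text \<open>Sharing a colour, \<open>b\<close> and \<open>b'\<close> are adjacent; the triangle on
  \<open>a\<close>, \<open>b\<close>, \<open>b'\<close> replaces \<open>b\<close> by
  \<open>b'\<close> at the cost of \<open>path (b', b)\<close>, which is itself a boundary.\<close>

lemma path_cong_right:
  assumes "a \<in> N" "b \<in> N" "b' \<in> N" "{a, b} \<in> K" "{a, b'} \<in> K" "\<kappa> b = \<kappa> b'"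
  shows "path (a, b) - path (a, b') \<in> link_boundaries"
proof -
  have "{b', b} \<in> K" using earlier_nbrs_clique[OF assms(3,2)] assms(6) by simp
  then have "{a, b, b'} \<in> earlier_link v"
    using assms by (intro earlier_link_triangleI) (auto simp: insert_commute)
  from path_triangle[OF this] have "path (a, b) - (path (a, b') + path (b', b)) \<in> link_boundaries" .
  moreover have "path (b', b) \<in> link_boundaries"
    using assms by (intro path_same_colour) auto
  ultimately have "path (a, b) - (path (a, b') + path (b', b)) + path (b', b) \<in> link_boundaries"
    by (rule chain_space.subspace_add[OF subspace_link_boundaries])
  then show ?thesis by (simp add: algebra_simps)
qed

lemma path_cong_left:
  assumes "a \<in> N" "a' \<in> N" "b \<in> N" "{a, b} \<in> K" "{a', b} \<in> K" "\<kappa> a = \<kappa> a'"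
  shows "path (a, b) - path (a', b) \<in> link_boundaries"
proof -
  have "path (b, a') - path (b, a) \<in> link_boundaries"
    using assms by (intro path_cong_right) (auto simp: insert_commute)
  then show ?thesis by (simp add: path_swap[of b])
qed

text \<open>An edge that is not new spans a triangle with some \<open>w\<close> of the colour of
  \<open>v\<close>, so modulo boundaries its path is a sum of two paths with an end in that colour.
  Edges of the latter kind are treated first.\<close>

lemma path_in_span:
  fixes X :: "('a list \<Rightarrow> 'k) set"
  assumes X: "chain_space.subspace X" "link_boundaries \<subseteq> X"
    and new: "\<And>i j. i \<in> P \<Longrightarrow> j \<in> P \<Longrightarrow> path ` new_edges v i j \<subseteq> X"
    and ab: "a \<in> N" "b \<in> N" "{a, b} \<in> K"
  shows "path (a, b) \<in> X"
proof -
  have P: "\<kappa> a \<in> P" if "a \<in> N" for a using that colours earlier_nbrs_subset by blast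
  have trans: "x \<in> X" if "x - y \<in> link_boundaries" "y \<in> X" for x y
  proof -
    have "x - y + y \<in> X" using that X by (intro chain_space.subspace_add) auto
    then show ?thesis by simp
  qed
  have *: "path (a, w) \<in> X" if "a \<in> N" "w \<in> N" "{a, w} \<in> K" "\<kappa> w = \<kappa> v" for a w
  proof (cases "\<kappa> a = \<kappa> w")
    case True
    then show ?thesis using path_same_colour[of a w] that X by auto
  next
    case False
    \<comment> \<open>Among the admissible end points the latest one, \<open>u\<close>, makes
      \<open>(a, u)\<close> new, by the exception for \<open>b\<close> of the colour of
      \<open>v\<close> in \<open>new_edges\<close>; passing from \<open>w\<close> to
      \<open>u\<close> changes the path only by a boundary.\<close>
    define W where "W = {w \<in> N. \<kappa> w = \<kappa> v \<and> {a, w} \<in> K}"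
    have "finite W" "w \<in> W" using that finite_earlier_nbrs[of v] by (auto simp: W_def)
    then have "Max (idx ` W) \<in> idx ` W" by (intro Max_in) auto
    then obtain u where "u \<in> W" and max: "Max (idx ` W) = idx u" by blast
    then have u: "u \<in> W" "\<And>w'. w' \<in> W \<Longrightarrow> idx w' \<le> idx u"
      using Max_ge[of "idx ` W"] \<open>finite W\<close> by auto
    then have "(a, u) \<in> new_edges v (\<kappa> a) (\<kappa> v)"
      using that False by (auto simp: new_edges_def W_def)
    then have "path (a, u) \<in> X" using new[of "\<kappa> a" "\<kappa> v"] P[of a] P[of w] that by auto
    moreover have "path (a, w) - path (a, u) \<in> link_boundaries"
      using that u(1) by (intro path_cong_right) (auto simp: W_def)
    ultimately show ?thesis using trans by blast
  qed
  show ?thesis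
  proof (cases "\<kappa> a = \<kappa> b \<or> (a, b) \<in> new_edges v (\<kappa> a) (\<kappa> b)")
    case True
    then show ?thesis using path_same_colour[of a b] ab X new P by blast
  next
    case False
    then obtain w where w: "w \<in> N" "\<kappa> w = \<kappa> v" "{a, w} \<in> K" "{b, w} \<in> K"
      using ab by (auto simp: new_edges_def)
    have "path (a, b) - (path (a, w) + path (w, b)) \<in> link_boundaries"
      using ab w by (intro path_triangle earlier_link_triangleI) auto
    moreover have "path (a, w) \<in> X" using * ab w by blast
    moreover have "path (w, b) \<in> X"
      using *[of b w] ab w chain_space.subspace_neg[OF X(1), of "path (b, w)"]
      by (simp add: path_swap[of b w] fun_Compl_def)
    ultimately show ?thesis using chain_space.subspace_add[OF X(1)] trans by blast
  qed
qed

lemma one_chains_span_edges: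
  fixes c :: "'a list \<Rightarrow> 'k"
  assumes "c \<in> oriented_chains (earlier_link v) 2"
  shows "c \<in> chain_space.span {edge a b | a b. a \<in> N \<and> b \<in> N \<and> {a, b} \<in> K}" (is "_ \<in> chain_space.span ?E")
  using assms
proof (induction "card {xs. c xs \<noteq> 0}" arbitrary: c rule: less_induct)
  case less
  note c = less.prems
  have supp: "length xs = 2 \<and> set xs \<subseteq> N" if "c xs \<noteq> 0" for xs
    using oriented_chains_support[OF c that] earlier_link_subset by blast
  then have "{xs. c xs \<noteq> 0} \<subseteq> {xs. set xs \<subseteq> N \<and> length xs = 2}" by blast
  then have fin: "finite {xs. c xs \<noteq> 0}"
    using finite_lists_length_eq[OF finite_earlier_nbrs] by (rule finite_subset)
  show ?case
  proof (cases "c = 0")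
    case True
    then show ?thesis by (simp add: chain_space.span_zero)
  next
    case False
    then obtain xs where xs: "c xs \<noteq> 0" by (auto simp: fun_eq_iff)
    then obtain a b where ab: "xs = [a, b]" using supp[OF xs] by (auto simp: length_Suc_conv numeral_2_eq_2)
    have link: "{a, b} \<in> earlier_link v" and "a \<noteq> b" using oriented_chains_support[OF c xs] ab by auto
    have sw: "c [b, a] = - c [a, b]" using oriented_chains_swap[OF c, of "[]" b a "[]"] by simp
    have e: "edge a b \<in> ?E" using earlier_link_subset[OF link] earlier_link_K[OF link] by auto
    have e2: "edge a b \<in> oriented_chains (earlier_link v) 2"
      unfolding edge_def using link \<open>a \<noteq> b\<close>
      by (intro wedge2_in_oriented_chains) (auto simp: ind_def insert_commute split: if_splits)
    \<comment> \<open>Both orientations of the edge leave the support, which drives the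
      induction.\<close>
    define c' where "c' = c - chain_scale (c [a, b]) (edge a b)"
    have c': "c' \<in> oriented_chains (earlier_link v) 2"
      unfolding c'_def using c e2
      by (intro chain_space.subspace_diff chain_space.subspace_scale subspace_oriented_chains)
    have "c' ys = (if ys = [a, b] \<or> ys = [b, a] then 0 else c ys)" for ys
      using \<open>a \<noteq> b\<close> sw
      by (auto simp: c'_def edge_def wedge2_def ind_def split: list.splits if_splits)
    then have "{ys. c' ys \<noteq> 0} \<subset> {ys. c ys \<noteq> 0}" using xs ab by auto
    then have "card {ys. c' ys \<noteq> 0} < card {ys. c ys \<noteq> 0}" by (rule psubset_card_mono[OF fin])
    from less.hyps[OF this c'] have "c' \<in> chain_space.span ?E" .
    moreover have "chain_scale (c [a, b]) (edge a b) \<in> chain_space.span ?E"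
      using e by (intro chain_space.span_scale chain_space.span_base)
    ultimately have "c' + chain_scale (c [a, b]) (edge a b) \<in> chain_space.span ?E"
      by (rule chain_space.span_add)
    then show ?thesis by (simp add: c'_def)
  qed
qed

lemma link_cycles_in_span:
  fixes X :: "('a list \<Rightarrow> 'k) set"
  assumes X: "chain_space.subspace X" "link_boundaries \<subseteq> X"
    and new: "\<And>i j. i \<in> P \<Longrightarrow> j \<in> P \<Longrightarrow> path ` new_edges v i j \<subseteq> X"
    and c: "c \<in> oriented_chains (earlier_link v) 2" "boundary K c = 0"
  shows "c \<in> X"
proof -
  \<comment> \<open>\<open>lift\<close> turns a combination of vertices into the same combination of
    legs from the base points. The map \<open>c - lift (boundary K c)\<close> is linear, gives
    \<open>path (a, b)\<close> on the edge from \<open>a\<close> to \<open>b\<close>, and fixes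
    cycles. Hence it is enough that all paths lie in \<open>X\<close>.\<close>
  define lift :: "('a list \<Rightarrow> 'k) \<Rightarrow> 'a list \<Rightarrow> 'k" where
    "lift c = (\<lambda>xs. \<Sum>a\<in>N. c [a] * edge (base (\<kappa> a)) a xs)" for c
  define Y where "Y = {c. c - lift (boundary K c) \<in> X}"
  have lift_add: "lift (c + c') = lift c + lift c'" for c c'
    by (simp add: lift_def fun_eq_iff algebra_simps sum.distrib)
  have lift_scale: "lift (chain_scale r c) = chain_scale r (lift c)" for c r
    by (simp add: lift_def fun_eq_iff sum_distrib_left mult.assoc)
  have "chain_space.subspace Y"
  proof (rule chain_space.subspaceI)
    have "lift (boundary K 0) = 0" by (simp add: lift_def boundary_def fun_eq_iff)
    then show "0 \<in> Y" using chain_space.subspace_0[OF X(1)] by (simp add: Y_def)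
  next
    fix x y assume "x \<in> Y" "y \<in> Y"
    moreover have "x + y - lift (boundary K (x + y)) = (x - lift (boundary K x)) + (y - lift (boundary K y))"
      by (simp add: boundary_add lift_add)
    ultimately show "x + y \<in> Y" using chain_space.subspace_add[OF X(1)] by (simp only: Y_def mem_Collect_eq)
  next
    fix r x assume "x \<in> Y"
    moreover have "chain_scale r x - lift (boundary K (chain_scale r x)) = chain_scale r (x - lift (boundary K x))"
      by (simp add: boundary_scale lift_scale fun_eq_iff algebra_simps)
    ultimately show "chain_scale r x \<in> Y"
      using chain_space.subspace_scale[OF X(1)] by (simp only: Y_def mem_Collect_eq)
  qed
  moreover have "{edge a b | a b. a \<in> N \<and> b \<in> N \<and> {a, b} \<in> K} \<subseteq> Y"
  proof clarify
    fix a b assume ab: "a \<in> N" "b \<in> N" "{a, b} \<in> K"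
    have "boundary K (edge a b) [x] = ind b x - ind a x" for x
      using ab earlier_nbrs_subset[of v] finite_S unfolding edge_def
      by (subst boundary_wedge2[where F = 1 and G = 1]) (auto simp: Union_K sum_ind)
    then have "lift (boundary K (edge a b)) xs =
        (\<Sum>x\<in>N. ind b x * edge (base (\<kappa> x)) x xs) - (\<Sum>x\<in>N. ind a x * edge (base (\<kappa> x)) x xs)" for xs
      by (simp add: lift_def left_diff_distrib sum_subtractf)
    moreover have "(\<Sum>x\<in>N. ind z x * edge (base (\<kappa> x)) x xs) = edge (base (\<kappa> z)) z xs" if "z \<in> N" for z xs
    proof -
      have "(\<Sum>x\<in>N. ind z x * edge (base (\<kappa> x)) x xs) = (\<Sum>x\<in>N. if x = z then edge (base (\<kappa> z)) z xs else 0)"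
        by (intro sum.cong) (auto simp: ind_def)
      then show ?thesis using that finite_earlier_nbrs[of v] by simp
    qed
    ultimately have "lift (boundary K (edge a b)) = edge (base (\<kappa> b)) b - edge (base (\<kappa> a)) a"
      using ab by (simp add: fun_eq_iff)
    then have "edge a b - lift (boundary K (edge a b)) = path (a, b)"
      by (simp add: path_def algebra_simps)
    then show "edge a b \<in> Y" using path_in_span[OF X new ab] by (simp add: Y_def)
  qed
  ultimately have "chain_space.span {edge a b | a b. a \<in> N \<and> b \<in> N \<and> {a, b} \<in> K} \<subseteq> Y"
    by (intro chain_space.span_minimal)
  then have "c \<in> Y" using one_chains_span_edges[OF c(1)] by blast
  moreover have "lift 0 = 0" by (simp add: lift_def fun_eq_iff)
  ultimately show ?thesis using c(2) by (simp add: Y_def)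
qed

lemma exists_induced_matchings:
  obtains M where "\<And>i j. M i j \<subseteq> new_edges v i j"
    "\<And>i j. induced_matching (colour_edges i j) (M i j)"
    "{c \<in> oriented_chains (earlier_link v) 2. boundary K c = 0} \<subseteq>
      chain_space.span (link_boundaries \<union> path ` (\<Union>i\<in>P. \<Union>j\<in>P. M i j) :: ('a list \<Rightarrow> 'k) set)"
proof -
  have "\<exists>M. M \<subseteq> new_edges v i j \<and>
      (path ` new_edges v i j :: ('a list \<Rightarrow> 'k) set) \<subseteq> chain_space.span (link_boundaries \<union> path ` M) \<and>
      (\<forall>x\<in>M. \<forall>y\<in>M. path x - path y \<in> (link_boundaries :: ('a list \<Rightarrow> 'k) set) \<longrightarrow> x = y)" for i j
    using chain_space.minimal_spanning_image[OF finite_new_edges, where f = path and B = "link_boundaries :: ('a list \<Rightarrow> 'k) set"]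
    unfolding span_link_boundaries by (metis (no_types, lifting))
  then obtain M where M: "\<And>i j. M i j \<subseteq> new_edges v i j"
    and sp: "\<And>i j. (path ` new_edges v i j :: ('a list \<Rightarrow> 'k) set) \<subseteq> chain_space.span (link_boundaries \<union> path ` M i j)"
    and inj: "\<And>i j x y. x \<in> M i j \<Longrightarrow> y \<in> M i j \<Longrightarrow>
      path x - path y \<in> (link_boundaries :: ('a list \<Rightarrow> 'k) set) \<Longrightarrow> x = y"
    by metis
  let ?X = "chain_space.span (link_boundaries \<union> path ` (\<Union>i\<in>P. \<Union>j\<in>P. M i j) :: ('a list \<Rightarrow> 'k) set)"
  have X1: "chain_space.subspace ?X" by simp
  have X2: "link_boundaries \<subseteq> ?X" by (auto intro: chain_space.span_base)
  have X3: "path ` new_edges v i j \<subseteq> ?X" if "i \<in> P" "j \<in> P" for i j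
  proof -
    have "link_boundaries \<union> path ` M i j \<subseteq> link_boundaries \<union> path ` (\<Union>i\<in>P. \<Union>j\<in>P. M i j)"
      using that by blast
    from chain_space.span_mono[OF this] sp[of i j] show ?thesis by (rule order_trans[rotated])
  qed
  \<comment> \<open>An edge of \<open>K\<close> from \<open>a\<close> to \<open>b'\<close> would
    make the paths of \<open>(a, b)\<close>, \<open>(a, b')\<close> and \<open>(a', b')\<close>
    congruent modulo boundaries, against the minimality of \<open>M i j\<close>.\<close>
  have "induced_matching (colour_edges i j) (M i j)" for i j
  proof -
    have no: False if ab: "(a, b) \<in> M i j" "(a', b') \<in> M i j" "(a, b) \<noteq> (a', b')" and e: "{a, b'} \<in> K"
      for a b a' b'
    proof -
      have "(a, b) \<in> new_edges v i j" "(a', b') \<in> new_edges v i j" using ab M by blast+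
      then have *: "a \<in> N" "b \<in> N" "a' \<in> N" "b' \<in> N" "{a, b} \<in> K" "{a', b'} \<in> K" "\<kappa> a = \<kappa> a'" "\<kappa> b = \<kappa> b'"
        by (auto simp: new_edges_def)
      have "path (a, b) - path (a, b') \<in> (link_boundaries :: ('a list \<Rightarrow> 'k) set)"
        using * e by (intro path_cong_right)
      moreover have "path (a, b') - path (a', b') \<in> (link_boundaries :: ('a list \<Rightarrow> 'k) set)"
        using * e by (intro path_cong_left)
      ultimately have "(path (a, b) - path (a, b')) + (path (a, b') - path (a', b'))
          \<in> (link_boundaries :: ('a list \<Rightarrow> 'k) set)"
        by (rule chain_space.subspace_add[OF subspace_link_boundaries])
      then show False using inj[OF ab(1,2)] ab(3) by simp
    qed
    show ?thesis
    proof (rule induced_matchingI)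
      show "M i j \<subseteq> colour_edges i j" using M[of i j] by (auto simp: new_edges_def colour_edges_def)
    qed (use no in \<open>auto simp: colour_edges_def\<close>)
  qed
  moreover have "{c \<in> oriented_chains (earlier_link v) 2. boundary K c = 0} \<subseteq> ?X"
    using link_cycles_in_span[OF X1 X2 X3] by blast
  ultimately show ?thesis using M that by blast
qed

text \<open>The Mayer--Vietoris step on chains: contraction with \<open>v\<close> maps cycles to
  cycles of the link, and a cycle whose contraction bounds in the link is homologous to one that
  avoids \<open>v\<close>. The other classes are counted by \<open>span_pullback\<close>.\<close>

lemma removal_step:
  assumes "finite T"
    and T: "{c \<in> oriented_chains (earlier_link v) 2. boundary K c = 0} \<subseteq> chain_space.span (link_boundaries \<union> T)"
  shows "\<exists>T'. finite T' \<and> card T' \<le> card T \<and>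
    (initial_cycles (Suc (idx v)) :: ('a list \<Rightarrow> 'k) set) \<subseteq>
      chain_space.span (initial_cycles (idx v) \<union> boundaries K 3 \<union> T')"
proof -
  let ?Z = "initial_cycles (Suc (idx v)) :: ('a list \<Rightarrow> 'k) set"
  have "contract v ` ?Z \<subseteq> chain_space.span (link_boundaries \<union> T)"
  proof -
    have "contract v c \<in> oriented_chains (earlier_link v) 2 \<and> boundary K (contract v c) = 0" if "c \<in> ?Z" for c
    proof
      have c: "c \<in> oriented_chains (initial_complex (Suc (idx v))) 3" "boundary K c = 0"
        using that by (auto simp: initial_cycles_def)
      show "contract v c \<in> oriented_chains (earlier_link v) 2"
      proof (rule contract_in_oriented_chains)
        show "c \<in> oriented_chains (initial_complex (Suc (idx v))) (Suc 2)" using c by simp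
        fix \<sigma> assume s: "insert v \<sigma> \<in> initial_complex (Suc (idx v))" "v \<notin> \<sigma>"
        then have "\<sigma> \<subseteq> S" using face_subset by (auto simp: initial_complex_def)
        then have "idx a < idx v" if "a \<in> \<sigma>" for a
          using s that idx_inj[of a v] v by (force simp: initial_complex_def less_Suc_eq)
        then show "\<sigma> \<in> earlier_link v" using s by (auto simp: earlier_link_def initial_complex_def)
      qed
      show "boundary K (contract v c) = 0"
        using boundary_contract[OF c(1), of K v] c(2) by (simp add: contract_def fun_eq_iff)
    qed
    then show ?thesis using T by blast
  qed
  then obtain T' where T': "finite T'" "card T' \<le> card T"
    "?Z \<subseteq> chain_space.span ({a \<in> ?Z. contract v a \<in> chain_space.span link_boundaries} \<union> T')"
    using chain_space.span_pullback[where \<phi> = "contract v", OF assms(1) subspace_initial_cycles contract_add contract_scale] by blast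
  have "a \<in> chain_space.span (initial_cycles (idx v) \<union> boundaries K 3)"
    if a: "a \<in> ?Z" "contract v a \<in> link_boundaries" for a
  proof -
    obtain w where w: "w \<in> oriented_chains (earlier_link v) 3" "contract v a = boundary K w"
      using a(2) by (auto simp: link_boundaries_def)
    define c where "c = cone_chain v w"
    have "c \<in> oriented_chains (initial_complex (Suc (idx v))) (Suc 3)"
      unfolding c_def using w(1)
      by (rule cone_in_oriented_chains) (auto simp: earlier_link_def initial_complex_def less_Suc_eq)
    then have c: "c \<in> oriented_chains (initial_complex (Suc (idx v))) (Suc 3)" "c \<in> oriented_chains K (Suc 3)"
      using oriented_chains_mono[of "initial_complex (Suc (idx v))" K] by (auto simp: initial_complex_def)
    have bd: "boundary K c \<in> boundaries K 3" using c(2) by (auto simp: boundaries_def)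
    have bd0: "boundary K (boundary K c) = 0"
      using boundaries_subset_cycles[OF complex finite_S, of 3] bd by (auto simp: cycles_def fun_eq_iff)
    have bdc: "boundary K c \<in> oriented_chains (initial_complex (Suc (idx v))) 3"
      using c(1) face_mono by (intro boundary_in_subcomplex) (auto simp: initial_complex_def)
    \<comment> \<open>The boundary of the cone over \<open>w\<close> contracts to
      \<open>- boundary K w\<close>, so adding it removes \<open>v\<close> from
      \<open>a\<close>.\<close>
    define a' where "a' = a + boundary K c"
    have a': "a' \<in> oriented_chains (initial_complex (Suc (idx v))) 3" "boundary K a' = 0"
      using a(1) bdc bd0 chain_space.subspace_add[OF subspace_oriented_chains]
      by (auto simp: a'_def initial_cycles_def boundary_add)
    have "boundary K w = - contract v (boundary K c)"
      using boundary_contract[OF c(2), of K v] by (simp add: c_def contract_cone)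
    then have "contract v a' = 0"
      using w(2) by (simp add: a'_def contract_add)
    note nv = contract_eq_0_support[OF a'(1) this]
    have "a' \<in> oriented_chains (initial_complex (idx v)) 3"
    proof (rule oriented_chainsI)
      fix xs assume nz: "a' xs \<noteq> 0"
      note xs = oriented_chains_support[OF a'(1) nz]
      have "set xs \<subseteq> S" using xs(3) face_subset by (auto simp: initial_complex_def)
      then have "idx x < idx v" if "x \<in> set xs" for x
        using xs(3) nv[OF nz] that v idx_inj[of x v] by (force simp: initial_complex_def less_Suc_eq)
      then show "length xs = 3 \<and> distinct xs \<and> set xs \<in> initial_complex (idx v)"
        using xs by (auto simp: initial_complex_def)
    next
      show "a' (us @ x # y # ws) = - a' (us @ y # x # ws)" for us x y ws
        by (rule oriented_chains_swap[OF a'(1)])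
    qed
    then have "a' \<in> initial_cycles (idx v)" using a'(2) by (simp add: initial_cycles_def)
    then have "a' - boundary K c \<in> chain_space.span (initial_cycles (idx v) \<union> boundaries K 3)"
      using bd by (intro chain_space.span_diff) (auto intro: chain_space.span_base)
    then show ?thesis by (simp add: a'_def)
  qed
  then have "{a \<in> ?Z. contract v a \<in> chain_space.span link_boundaries} \<union> T'
      \<subseteq> chain_space.span (initial_cycles (idx v) \<union> boundaries K 3 \<union> T')"
    using chain_space.span_mono[of "initial_cycles (idx v) \<union> boundaries K 3" "initial_cycles (idx v) \<union> boundaries K 3 \<union> T'"]
    by (auto simp: span_link_boundaries intro: chain_space.span_base)
  then have "chain_space.span ({a \<in> ?Z. contract v a \<in> chain_space.span link_boundaries} \<union> T')
      \<subseteq> chain_space.span (initial_cycles (idx v) \<union> boundaries K 3 \<union> T')"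
    by (simp add: chain_space.span_minimal)
  then show ?thesis using T' by blast
qed

end

section \<open>Summation over all vertices\<close>

context clique_coloured_complex
begin

lemma exists_induced_matchings_step:
  assumes "v \<in> S"
  shows "\<exists>M. (\<forall>i j. M i j \<subseteq> new_edges v i j \<and> induced_matching (colour_edges i j) (M i j)) \<and>
    (\<exists>T. finite T \<and> card T \<le> (\<Sum>i\<in>P. \<Sum>j\<in>P. card (M i j)) \<and>
      (initial_cycles (Suc (idx v)) :: ('a list \<Rightarrow> 'k::field) set) \<subseteq>
        chain_space.span (initial_cycles (idx v) \<union> boundaries K 3 \<union> T))"
proof -
  interpret vertex_removal S K \<kappa> P idx v "TYPE('k)"
    by unfold_locales (rule assms)
  obtain M where M: "\<And>i j. M i j \<subseteq> new_edges v i j"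
    "\<And>i j. induced_matching (colour_edges i j) (M i j)"
    "{c \<in> oriented_chains (earlier_link v) 2. boundary K c = 0} \<subseteq>
      chain_space.span (link_boundaries \<union> path ` (\<Union>i\<in>P. \<Union>j\<in>P. M i j))"
    by (rule exists_induced_matchings) (rule that)
  let ?T = "path ` (\<Union>i\<in>P. \<Union>j\<in>P. M i j) :: ('a list \<Rightarrow> 'k) set"
  have fin: "finite (M i j)" for i j
    using M(1) finite_new_edges by (rule finite_subset)
  then have "finite (\<Union>i\<in>P. \<Union>j\<in>P. M i j)" using finite_P by blast
  then have finT: "finite ?T" and "card ?T \<le> card (\<Union>i\<in>P. \<Union>j\<in>P. M i j)" by (simp_all add: card_image_le)
  note this(2)
  also have "card (\<Union>i\<in>P. \<Union>j\<in>P. M i j) \<le> (\<Sum>i\<in>P. card (\<Union>j\<in>P. M i j))"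
    by (rule card_UN_le[OF finite_P])
  also have "\<dots> \<le> (\<Sum>i\<in>P. \<Sum>j\<in>P. card (M i j))"
    by (intro sum_mono card_UN_le[OF finite_P])
  finally have "card ?T \<le> (\<Sum>i\<in>P. \<Sum>j\<in>P. card (M i j))" .
  moreover obtain T' where "finite T'" "card T' \<le> card ?T"
    "(initial_cycles (Suc (idx v)) :: ('a list \<Rightarrow> 'k) set) \<subseteq>
        chain_space.span (initial_cycles (idx v) \<union> boundaries K 3 \<union> T')"
    using removal_step[OF finT M(3)] by blast
  ultimately show ?thesis using M(1,2) by (intro exI[of _ M] conjI allI exI[of _ T']) auto
qed

lemma initial_cycles_0: "initial_cycles 0 = {0}"
proof -
  have "c = 0" if "c \<in> oriented_chains (initial_complex 0) 3" for c :: "'a list \<Rightarrow> 'b"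
  proof
    fix xs
    show "c xs = 0 xs"
    proof (rule ccontr)
      assume "c xs \<noteq> 0 xs"
      then have "c xs \<noteq> 0" by simp
      from oriented_chains_support[OF that this] have "length xs = 3" "set xs \<in> initial_complex 0" by auto
      then show False by (cases xs) (auto simp: initial_complex_def)
    qed
  qed
  then show ?thesis using chain_space.subspace_0[OF subspace_initial_cycles, of 0]
    by (auto simp: initial_cycles_def)
qed

lemma initial_cycles_card: "initial_cycles (card S) = cycles K 3"
proof -
  have "idx a < card S" if "\<sigma> \<in> K" "a \<in> \<sigma>" for \<sigma> a
    using idx face_subset[OF that(1)] that(2) by (auto simp: bij_betw_def)
  then have "initial_complex (card S) = K" by (auto simp: initial_complex_def)
  then show ?thesis by (simp add: initial_cycles_def cycles_def zero_fun_def)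
qed

text \<open>Adding the vertices in order, each one contributes the sizes of its matchings. For a
  fixed colour of the removed vertex and a fixed pair \<open>i\<close>, \<open>j\<close>, these
  matchings are disjoint and induced in one bipartite graph, so each triple of colours contributes
  at most \<open>max_induced_matchings n\<close>.\<close>

lemma reduced_betti_2_le:
  assumes "card S \<le> n"
  shows "reduced_betti TYPE('k::field) 2 K \<le> card P ^ 3 * max_induced_matchings n"
proof -
  have "\<forall>v\<in>S. \<exists>M. (\<forall>i j. M i j \<subseteq> new_edges v i j \<and> induced_matching (colour_edges i j) (M i j)) \<and>
    (\<exists>T. finite T \<and> card T \<le> (\<Sum>i\<in>P. \<Sum>j\<in>P. card (M i j)) \<and>
      (initial_cycles (Suc (idx v)) :: ('a list \<Rightarrow> 'k::field) set) \<subseteq>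
        chain_space.span (initial_cycles (idx v) \<union> boundaries K 3 \<union> T))"
    using exists_induced_matchings_step by blast
  from bchoice[OF this] obtain M where
    M: "\<And>v i j. v \<in> S \<Longrightarrow> M v i j \<subseteq> new_edges v i j"
      "\<And>v i j. v \<in> S \<Longrightarrow> induced_matching (colour_edges i j) (M v i j)"
    and step: "\<And>v. v \<in> S \<Longrightarrow> \<exists>T. finite T \<and> card T \<le> (\<Sum>i\<in>P. \<Sum>j\<in>P. card (M v i j)) \<and>
      (initial_cycles (Suc (idx v)) :: ('a list \<Rightarrow> 'k::field) set) \<subseteq>
        chain_space.span (initial_cycles (idx v) \<union> boundaries K 3 \<union> T)"
    by blast
  define w where "w v = (\<Sum>i\<in>P. \<Sum>j\<in>P. card (M v i j))" for v
  have "\<exists>T. finite T \<and> card T \<le> (\<Sum>v\<in>{v \<in> S. idx v < s}. w v) \<and>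
      (initial_cycles s :: ('a list \<Rightarrow> 'k) set) \<subseteq> chain_space.span (boundaries K 3 \<union> T)" if "s \<le> card S" for s
    using that
  proof (induction s)
    case 0
    then show ?case by (intro exI[of _ "{}"]) (auto simp: initial_cycles_0 chain_space.span_zero)
  next
    case (Suc s)
    then obtain T where T: "finite T" "card T \<le> (\<Sum>v\<in>{v \<in> S. idx v < s}. w v)"
      "(initial_cycles s :: ('a list \<Rightarrow> 'k) set) \<subseteq> chain_space.span (boundaries K 3 \<union> T)" by auto
    have "s \<in> idx ` S" using Suc.prems idx by (auto simp: bij_betw_def)
    then obtain v where v: "v \<in> S" "s = idx v" by blast
    obtain T' where T': "finite T'" "card T' \<le> w v"
      "(initial_cycles (Suc s) :: ('a list \<Rightarrow> 'k) set) \<subseteq>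
        chain_space.span (initial_cycles s \<union> boundaries K 3 \<union> T')"
      using step[OF v(1)] v(2) unfolding w_def by blast
    have "initial_cycles s \<union> boundaries K 3 \<union> T' \<subseteq> chain_space.span (boundaries K 3 \<union> (T \<union> T'))"
      using T(3) chain_space.span_mono[of "boundaries K 3 \<union> T" "boundaries K 3 \<union> (T \<union> T')"]
        chain_space.span_superset[of "boundaries K 3 \<union> (T \<union> T')"] by blast
    then have "chain_space.span (initial_cycles s \<union> boundaries K 3 \<union> T')
        \<subseteq> chain_space.span (boundaries K 3 \<union> (T \<union> T'))"
      by (rule chain_space.span_minimal) simp
    moreover have "{u \<in> S. idx u < Suc s} = insert v {u \<in> S. idx u < s}"
      using v idx_inj[of _ v] by (auto simp: less_Suc_eq)
    then have "card (T \<union> T') \<le> (\<Sum>u\<in>{u \<in> S. idx u < Suc s}. w u)"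
      using card_Un_le[of T T'] T(2) T'(2) v finite_S by simp
    ultimately show ?case using T(1) T'(1,3) by (intro exI[of _ "T \<union> T'"]) auto
  qed
  from this[of "card S"] obtain T where T: "finite T" "card T \<le> (\<Sum>v\<in>{v \<in> S. idx v < card S}. w v)"
    "(cycles K 3 :: ('a list \<Rightarrow> 'k) set) \<subseteq> chain_space.span (boundaries K 3 \<union> T)"
    by (auto simp: initial_cycles_card)
  obtain F :: "('a list \<Rightarrow> 'k) set" where F: "finite F" "oriented_chains K 3 \<subseteq> chain_space.span F"
    using oriented_chains_finite_span[OF finite_S face_subset] .
  have Z: "cycles K 3 \<subseteq> chain_space.span F" using F(2) by (auto simp: cycles_def)
  have B: "boundaries K 3 \<subseteq> chain_space.span F"
    using Z boundaries_subset_cycles[OF complex finite_S, of 3] by (rule order_trans[rotated])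
  have "reduced_betti TYPE('k) 2 K \<le> card T"
    using chain_space.dim_le_dim_plus_card[OF F(1) Z B T(1,3)] by (simp add: reduced_betti_def)
  also have "\<dots> \<le> (\<Sum>v\<in>S. w v)"
    using T(2) sum_mono2[OF finite_S, of "{v \<in> S. idx v < card S}" w] by auto
  also have "\<dots> = (\<Sum>l\<in>P. \<Sum>v\<in>{v \<in> S. \<kappa> v = l}. w v)"
    by (rule sum.group[symmetric]) (use finite_S finite_P colours in auto)
  also have "\<dots> \<le> (\<Sum>l\<in>P. \<Sum>i\<in>P. \<Sum>j\<in>P. max_induced_matchings n)"
  proof (rule sum_mono)
    fix l
    have le: "(\<Sum>v\<in>{v \<in> S. \<kappa> v = l}. card (M v i j)) \<le> max_induced_matchings n" for i j
    proof (rule sum_induced_matchings_le)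
      let ?c = "\<lambda>i. {a \<in> S. \<kappa> a = i}"
      have c: "finite (?c i)" "card (?c i) \<le> n" for i
        using finite_S card_mono[OF finite_S, of "?c i"] assms by auto
      show "finite (?c i)" "finite (?c j)" "card (?c i) \<le> n" "card (?c j) \<le> n" "finite (?c l)" "card (?c l) \<le> n"
        by (rule c)+
      show "colour_edges i j \<subseteq> ?c i \<times> ?c j" using face_subset by (auto simp: colour_edges_def)
      show "induced_matching (colour_edges i j) (M v i j)" if "v \<in> ?c l" for v
        using M(2) that by blast
      show "disjoint_family_on (\<lambda>v. M v i j) (?c l)"
        unfolding disjoint_family_on_def
      proof (intro ballI impI)
        fix v v' assume v: "v \<in> ?c l" "v' \<in> ?c l" "v \<noteq> v'"
        then show "M v i j \<inter> M v' i j = {}"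
          using new_edges_disjoint[of v v' i j] M(1)[of v i j] M(1)[of v' i j] by auto
      qed
    qed
    have "(\<Sum>v\<in>{v \<in> S. \<kappa> v = l}. w v) = (\<Sum>i\<in>P. \<Sum>v\<in>{v \<in> S. \<kappa> v = l}. \<Sum>j\<in>P. card (M v i j))"
      unfolding w_def by (rule sum.swap)
    also have "\<dots> = (\<Sum>i\<in>P. \<Sum>j\<in>P. \<Sum>v\<in>{v \<in> S. \<kappa> v = l}. card (M v i j))"
      by (rule sum.cong[OF refl sum.swap])
    also have "\<dots> \<le> (\<Sum>i\<in>P. \<Sum>j\<in>P. max_induced_matchings n)"
      by (intro sum_mono le)
    finally show "(\<Sum>v\<in>{v \<in> S. \<kappa> v = l}. w v) \<le> (\<Sum>i\<in>P. \<Sum>j\<in>P. max_induced_matchings n)" .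
  qed
  also have "\<dots> = card P ^ 3 * max_induced_matchings n" by (simp add: power3_eq_cube)
  finally show ?thesis .
qed

end

section \<open>Periodic colouring of space by small cells\<close>

lemma exists_grid_colouring:
  assumes "0 < \<alpha>"
  obtains \<kappa> :: "real ^ 'd::finite \<Rightarrow> 'd \<Rightarrow> int" and P where "finite P" "range \<kappa> \<subseteq> P"
    "\<And>x y. \<kappa> x = \<kappa> y \<Longrightarrow> dist x y \<le> 2 \<Longrightarrow> dist x y \<le> \<alpha>"
proof -
  \<comment> \<open>Coordinate differences of at most \<open>\<delta>\<close> add up to a distance
    of at most \<alpha>.\<close>
  define \<delta> where "\<delta> = \<alpha> / CARD('d)"
  have \<delta>: "\<delta> > 0" using assms by (simp add: \<delta>_def)
  \<comment> \<open>The period: distinct cells with equal residues differ by at least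
    \<open>m\<close> in some coordinate, which forces a gap of more than
    \<open>(m - 1) * \<delta> \<ge> 2\<close> there.\<close>
  define m where "m = \<lceil>2 / \<delta>\<rceil> + 1"
  have m: "m > 0" "(real_of_int m - 1) * \<delta> \<ge> 2"
  proof -
    have "2 / \<delta> > 0" using \<delta> by simp
    then show "m > 0" unfolding m_def by linarith
    have "2 / \<delta> \<le> real_of_int m - 1" unfolding m_def by (simp add: le_of_int_ceiling)
    then show "(real_of_int m - 1) * \<delta> \<ge> 2" using \<delta> by (simp add: field_simps)
  qed
  define \<kappa> :: "real ^ 'd \<Rightarrow> 'd \<Rightarrow> int" where "\<kappa> x = (\<lambda>i. \<lfloor>x $ i / \<delta>\<rfloor> mod m)" for x
  define P :: "('d \<Rightarrow> int) set" where "P = (UNIV \<rightarrow>\<^sub>E {0..<m})"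
  have "finite P" unfolding P_def by (intro finite_PiE) auto
  moreover have "range \<kappa> \<subseteq> P" using m(1) by (auto simp: \<kappa>_def P_def)
  moreover have "dist x y \<le> \<alpha>" if eq: "\<kappa> x = \<kappa> y" and d: "dist x y \<le> 2" for x y
  proof -
    have "\<bar>(x - y) $ i\<bar> \<le> \<delta>" for i
    proof -
      have 1: "\<bar>x $ i - y $ i\<bar> \<le> 2"
        using component_le_norm_cart[of "x - y" i] d by (simp add: dist_norm)
      define a b where "a = \<lfloor>x $ i / \<delta>\<rfloor>" and "b = \<lfloor>y $ i / \<delta>\<rfloor>"
      have ab: "of_int a \<le> x $ i / \<delta>" "x $ i / \<delta> < of_int a + 1" "of_int b \<le> y $ i / \<delta>" "y $ i / \<delta> < of_int b + 1"
        unfolding a_def b_def by linarith+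
      then have *: "of_int a * \<delta> \<le> x $ i" "x $ i < (of_int a + 1) * \<delta>" "of_int b * \<delta> \<le> y $ i" "y $ i < (of_int b + 1) * \<delta>"
        using \<delta> by (simp_all add: field_simps)
      have "a mod m = b mod m" using fun_cong[OF eq, of i] by (simp add: \<kappa>_def a_def b_def)
      then have "m dvd a - b" by (simp add: mod_eq_dvd_iff)
      have "a = b"
      proof (rule ccontr)
        assume "a \<noteq> b"
        then have "m \<le> \<bar>a - b\<bar>" using \<open>m dvd a - b\<close> m(1) dvd_imp_le_int[of "a - b" m] by auto
        then consider "real_of_int m \<le> real_of_int a - real_of_int b" | "real_of_int m \<le> real_of_int b - real_of_int a"
          by linarith
        then show False
        proof cases
          case 1
          then have "(real_of_int m - 1) * \<delta> \<le> (real_of_int a - real_of_int b - 1) * \<delta>"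
            using \<delta> by (intro mult_right_mono) auto
          also have "\<dots> < x $ i - y $ i" using * by (simp add: algebra_simps)
          finally show False using \<open>\<bar>x $ i - y $ i\<bar> \<le> 2\<close> m(2) by linarith
        next
          case 2
          then have "(real_of_int m - 1) * \<delta> \<le> (real_of_int b - real_of_int a - 1) * \<delta>"
            using \<delta> by (intro mult_right_mono) auto
          also have "\<dots> < y $ i - x $ i" using * by (simp add: algebra_simps)
          finally show False using \<open>\<bar>x $ i - y $ i\<bar> \<le> 2\<close> m(2) by linarith
        qed
      qed
      then show ?thesis using * by (simp add: algebra_simps abs_le_iff)
    qed
    then have "(\<Sum>i\<in>UNIV. \<bar>(x - y) $ i\<bar>) \<le> (\<Sum>i\<in>(UNIV::'d set). \<delta>)" by (intro sum_mono)
    then show ?thesis using norm_le_l1_cart[of "x - y"] by (simp add: dist_norm \<delta>_def)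
  qed
  ultimately show ?thesis by (rule that)
qed

text \<open>\<open>D\<close> is fixed before \<open>n\<close>, because the number of colours depends
  only on \<alpha> and the dimension.\<close>

lemma quasi_rips_reduced_betti_2_le:
  assumes "0 < \<alpha>"
  obtains D :: nat where "\<And>n \<Gamma>. \<Gamma> \<in> (quasi_rips_complexes \<alpha> n :: (real ^ 'd::finite) set set set) \<Longrightarrow>
    reduced_betti TYPE('k::field) 2 \<Gamma> \<le> D * max_induced_matchings n"
proof -
  obtain \<kappa> :: "real ^ 'd \<Rightarrow> 'd \<Rightarrow> int" and P where P: "finite P" "range \<kappa> \<subseteq> P"
    "\<And>x y. \<kappa> x = \<kappa> y \<Longrightarrow> dist x y \<le> 2 \<Longrightarrow> dist x y \<le> \<alpha>"
    by (rule exists_grid_colouring[OF assms]) (rule that)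
  have "reduced_betti TYPE('k) 2 \<Gamma> \<le> card P ^ 3 * max_induced_matchings n"
    if "\<Gamma> \<in> (quasi_rips_complexes \<alpha> n :: (real ^ 'd) set set set)" for n \<Gamma>
  proof -
    obtain S where S: "finite S" "card S \<le> n" "quasi_rips \<alpha> S \<Gamma>"
      using \<open>\<Gamma> \<in> quasi_rips_complexes \<alpha> n\<close> by (auto simp: quasi_rips_complexes_def)
    have flag: "flag_complex S \<Gamma>" using S(3) by (simp add: quasi_rips_def)
    then have complex: "simplicial_complex S \<Gamma>" by (simp add: flag_complex_def)
    have faces: "\<forall>\<sigma>\<in>\<Gamma>. \<sigma> \<subseteq> S" and vertex: "\<forall>a\<in>S. {a} \<in> \<Gamma>"
      using complex by (simp_all add: simplicial_complex_def)
    have verts: "a \<in> S" "b \<in> S" if "{a, b} \<in> \<Gamma>" for a b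
      using bspec[OF faces that] by simp_all
    have close: "dist a b \<le> 1" if "{a, b} \<in> \<Gamma>" for a b
    proof (cases "a = b")
      case False
      then have "\<not> dist a b > 1" using S(3) that verts[OF that] unfolding quasi_rips_def by blast
      then show ?thesis by simp
    qed simp
    obtain idx where idx: "bij_betw idx S {..<card S}"
      using ex_bij_betw_finite_nat[OF S(1)] by (auto simp: atLeast0LessThan)
    interpret clique_coloured_complex S \<Gamma> \<kappa> P idx
    proof
      fix v a b assume ab: "{a, v} \<in> \<Gamma>" "{b, v} \<in> \<Gamma>" "\<kappa> a = \<kappa> b"
      \<comment> \<open>Two edges of length at most 1 meet at \<open>v\<close>; this is the source
        of the bound 2 in the colouring.\<close>
      have "dist a b \<le> 2" using close[OF ab(1)] close[OF ab(2)] dist_triangle2[of a b v] by simp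
      then have "dist a b \<le> \<alpha>" using P(3)[OF ab(3)] by simp
      moreover have "{a} \<in> \<Gamma>" using vertex verts[OF ab(1)] by simp
      ultimately show "{a, b} \<in> \<Gamma>"
        using S(3) verts[OF ab(1)] verts[OF ab(2)] unfolding quasi_rips_def by (cases "a = b") simp_all
    next
      show "\<kappa> ` S \<subseteq> P" using P(2) by blast
    qed (fact S(1) flag P(1) idx)+
    show ?thesis using reduced_betti_2_le[OF S(2)] .
  qed
  then show ?thesis by (rule that)
qed

section \<open>Octahedra\<close>

text \<open>
  The octahedra with opposite pairs \<open>(w, x)\<close>, \<open>(u, v')\<close>, \<open>(v, u')\<close> are cycles; the coefficient of the facet
  \<open>{w, u, v}\<close> vanishes on boundaries, and separates the octahedra.
\<close>

lemma octahedra_reduced_betti_ge: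
  fixes w x u v u' v' :: "'j \<Rightarrow> 'a"
  assumes complex: "simplicial_complex S K" and "finite S" "finite J"
    and faces: "\<And>j p q r. j \<in> J \<Longrightarrow> p \<in> {w j, x j} \<Longrightarrow> q \<in> {u j, v' j} \<Longrightarrow> r \<in> {v j, u' j} \<Longrightarrow> {p, q, r} \<in> K"
    and facet: "\<And>j y. j \<in> J \<Longrightarrow> y \<notin> {w j, u j, v j} \<Longrightarrow> insert y {w j, u j, v j} \<notin> K"
    and disj: "\<And>i j. i \<in> J \<Longrightarrow> j \<in> J \<Longrightarrow> w i \<notin> {x j, u j, v j, u' j, v' j} \<and> u i \<notin> {w j, x j, v j, v' j}
      \<and> v i \<notin> {w j, x j, u j, u' j}"
    and base: "\<And>i j. i \<in> J \<Longrightarrow> j \<in> J \<Longrightarrow> w i = w j \<Longrightarrow> u i \<noteq> u' j"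
    and inj: "\<And>i j. i \<in> J \<Longrightarrow> j \<in> J \<Longrightarrow> w i = w j \<Longrightarrow> u i = u j \<Longrightarrow> v i = v j \<Longrightarrow> i = j"
  shows "card J \<le> reduced_betti TYPE('k::field) 2 K"
proof -
  define z :: "'j \<Rightarrow> 'a list \<Rightarrow> 'k" where
    "z j = wedge3 (\<lambda>a. ind (w j) a - ind (x j) a) (\<lambda>a. ind (u j) a - ind (v' j) a)
       (\<lambda>a. ind (v j) a - ind (u' j) a)" for j
  have sub: "\<sigma> \<subseteq> S" if "\<sigma> \<in> K" for \<sigma>
    using complex that by (auto simp: simplicial_complex_def)
  have UK: "\<Union>K = S" using complex by (auto simp: simplicial_complex_def)
  have zZ: "z j \<in> cycles K 3" if j: "j \<in> J" for j
  proof -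
    let ?f = "\<lambda>a. ind (w j) a - ind (x j) a :: 'k" and ?g = "\<lambda>a. ind (u j) a - ind (v' j) a :: 'k"
      and ?h = "\<lambda>a. ind (v j) a - ind (u' j) a :: 'k"
    have f: "a \<in> {w j, x j}" if "?f a \<noteq> 0" for a using that by (auto simp: ind_def split: if_splits)
    have g: "a \<in> {u j, v' j}" if "?g a \<noteq> 0" for a using that by (auto simp: ind_def split: if_splits)
    have h: "a \<in> {v j, u' j}" if "?h a \<noteq> 0" for a using that by (auto simp: ind_def split: if_splits)
    have *: "{a, b, c} \<in> K" if "?f a * ?g b * ?h c \<noteq> 0" for a b c
    proof -
      have "?f a \<noteq> 0" "?g b \<noteq> 0" "?h c \<noteq> 0" using that by auto
      from faces[OF j f[OF this(1)] g[OF this(2)] h[OF this(3)]] show ?thesis .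
    qed
    have "z j \<in> oriented_chains K 3"
      unfolding z_def
    proof (rule wedge3_in_oriented_chains)
      fix a b c assume nz: "wedge3 ?f ?g ?h [a, b, c] \<noteq> 0"
      \<comment> \<open>The six terms of the determinant: a nonzero value makes one of them nonzero,
        and that term names a face.\<close>
      have "wedge3 ?f ?g ?h [a, b, c] = ?f a * ?g b * ?h c - ?f a * ?g c * ?h b - ?f b * ?g a * ?h c
          + ?f c * ?g a * ?h b + ?f b * ?g c * ?h a - ?f c * ?g b * ?h a"
        unfolding wedge3_simps wedge2_simps by (simp only: ring_distribs mult_ac) simp
      with nz have "?f a * ?g b * ?h c \<noteq> 0 \<or> ?f a * ?g c * ?h b \<noteq> 0 \<or> ?f b * ?g a * ?h c \<noteq> 0
          \<or> ?f c * ?g a * ?h b \<noteq> 0 \<or> ?f b * ?g c * ?h a \<noteq> 0 \<or> ?f c * ?g b * ?h a \<noteq> 0"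
        by (metis add.right_neutral diff_zero)
      then have "{a, b, c} \<in> K \<or> {a, c, b} \<in> K \<or> {b, a, c} \<in> K \<or> {c, a, b} \<in> K \<or> {b, c, a} \<in> K \<or> {c, b, a} \<in> K"
        using *[of a b c] *[of a c b] *[of b a c] *[of c a b] *[of b c a] *[of c b a] by blast
      moreover have "{a, c, b} = {a, b, c}" "{b, a, c} = {a, b, c}" "{c, a, b} = {a, b, c}"
        "{b, c, a} = {a, b, c}" "{c, b, a} = {a, b, c}" by auto
      ultimately show "{a, b, c} \<in> K" by simp
    qed
    moreover have "boundary K (z j) = (\<lambda>_. 0)"
    proof -
      have "w j \<in> S" "x j \<in> S" "u j \<in> S" "v' j \<in> S" "v j \<in> S" "u' j \<in> S"
        using sub[OF faces[OF j, of "w j" "u j" "v j"]] sub[OF faces[OF j, of "x j" "v' j" "u' j"]] by auto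
      then show ?thesis unfolding z_def using \<open>finite S\<close>
        by (subst boundary_wedge3[where F = 0 and G = 0 and H = 0])
           (auto simp: UK sum_subtractf sum_ind fun_eq_iff)
    qed
    ultimately show ?thesis by (simp add: cycles_def)
  qed
  \<comment> \<open>By \<open>disj\<close> the determinant reduces to [w i = w j] times the
    difference of [u i = u j][v i = v j] and [v i = v' j][u i = u' j]; \<open>base\<close> removes
    the second product and \<open>inj\<close> identifies the first.\<close>
  have dual: "z j [w i, u i, v i] = (if i = j then 1 else 0)" if ij: "i \<in> J" "j \<in> J" for i j
  proof -
    show ?thesis
    proof (cases "w i = w j")
      case True
      then show ?thesis
        unfolding z_def using disj[OF ij] base[OF ij True] inj[OF ij True] by (auto simp: ind_def)
    next
      case False
      then show ?thesis unfolding z_def using disj[OF ij] by (auto simp: ind_def)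
    qed
  qed
  have van: "b [w i, u i, v i] = 0" if i: "i \<in> J" and b: "b \<in> boundaries K 3" for i and b :: "'a list \<Rightarrow> 'k"
  proof -
    obtain d where d: "d \<in> oriented_chains K (Suc 3)" "b = boundary K d" using b by (auto simp: boundaries_def)
    \<comment> \<open>A nonzero coefficient would exhibit a face strictly containing the
      facet.\<close>
    have "d (y # [w i, u i, v i]) = 0" for y
    proof (rule ccontr)
      assume "d (y # [w i, u i, v i]) \<noteq> 0"
      from oriented_chains_support(2,3)[OF d(1) this] facet[OF i, of y] show False by auto
    qed
    then show ?thesis by (simp add: d(2) boundary_def)
  qed
  obtain F :: "('a list \<Rightarrow> 'k) set" where F: "finite F" "oriented_chains K 3 \<subseteq> chain_space.span F"
    using oriented_chains_finite_span[OF \<open>finite S\<close> sub] .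
  have "chain_space.dim (boundaries K 3 :: ('a list \<Rightarrow> 'k) set) + card J \<le> chain_space.dim (cycles K 3 :: ('a list \<Rightarrow> 'k) set)"
  proof (rule chain_space.dim_plus_card_le_dim[where f = "\<lambda>i c. c [w i, u i, v i]" and z = z, OF F(1)])
    show "cycles K 3 \<subseteq> chain_space.span F" using F(2) by (auto simp: cycles_def)
    show "boundaries K 3 \<subseteq> (cycles K 3 :: ('a list \<Rightarrow> 'k) set)"
      by (rule boundaries_subset_cycles[OF complex \<open>finite S\<close>])
  qed (use \<open>finite J\<close> zZ dual van in auto)
  then show ?thesis by (simp add: reduced_betti_def)
qed

section \<open>Clique complexes on labelled points\<close>

definition clique_complex_image :: "('b \<Rightarrow> 'a) \<Rightarrow> 'b set \<Rightarrow> ('b \<Rightarrow> 'b \<Rightarrow> bool) \<Rightarrow> 'a set set" where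
  "clique_complex_image f X A = {f ` \<sigma> | \<sigma>. \<sigma> \<subseteq> X \<and> (\<forall>p\<in>\<sigma>. \<forall>q\<in>\<sigma>. A p q)}"

text \<open>Injectivity recovers the clique from its image, so that faces can be tested on labels
  instead of points of space.\<close>

lemma image_in_clique_complex_image:
  assumes "inj_on f X" "\<sigma> \<subseteq> X"
  shows "f ` \<sigma> \<in> clique_complex_image f X A \<longleftrightarrow> (\<forall>p\<in>\<sigma>. \<forall>q\<in>\<sigma>. A p q)"
proof
  assume "f ` \<sigma> \<in> clique_complex_image f X A"
  then obtain \<tau> where t: "f ` \<sigma> = f ` \<tau>" "\<tau> \<subseteq> X" "\<forall>p\<in>\<tau>. \<forall>q\<in>\<tau>. A p q"
    unfolding clique_complex_image_def by blast
  then have "\<sigma> = \<tau>" using inj_on_image_eq_iff[OF assms(1,2)] by blast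
  then show "\<forall>p\<in>\<sigma>. \<forall>q\<in>\<sigma>. A p q" using t by blast
qed (use assms in \<open>auto simp: clique_complex_image_def\<close>)

lemma flag_complex_clique_complex_image:
  assumes "finite X" "inj_on f X" "\<And>p. p \<in> X \<Longrightarrow> A p p"
  shows "flag_complex (f ` X) (clique_complex_image f X A)"
proof -
  let ?K = "clique_complex_image f X A"
  note mem = image_in_clique_complex_image[OF assms(2)]
  have "simplicial_complex (f ` X) ?K"
    unfolding simplicial_complex_def
  proof (intro conjI ballI allI impI)
    show "{} \<in> ?K" using mem[of "{}"] by simp
  next
    fix \<sigma> assume "\<sigma> \<in> ?K"
    then obtain \<rho> where r: "\<sigma> = f ` \<rho>" "\<rho> \<subseteq> X" "\<forall>p\<in>\<rho>. \<forall>q\<in>\<rho>. A p q"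
      unfolding clique_complex_image_def by blast
    then show "finite \<sigma>" "\<sigma> \<subseteq> f ` X" using finite_subset[OF _ assms(1)] by auto
    fix \<tau> assume "\<tau> \<subseteq> \<sigma>"
    then obtain \<rho>' where "\<rho>' \<subseteq> \<rho>" "\<tau> = f ` \<rho>'" unfolding r(1) by (meson subset_image_iff)
    moreover from this have "\<rho>' \<subseteq> X" "\<forall>p\<in>\<rho>'. \<forall>q\<in>\<rho>'. A p q" using r by blast+
    ultimately show "\<tau> \<in> ?K" using mem[of \<rho>'] by simp
  next
    fix v assume "v \<in> f ` X"
    then obtain p where "p \<in> X" "v = f p" by blast
    then show "{v} \<in> ?K" using mem[of "{p}"] assms(3) by simp
  qed
  moreover have "\<sigma> \<in> ?K" if s: "\<sigma> \<subseteq> f ` X" "\<forall>e\<subseteq>\<sigma>. card e = 2 \<longrightarrow> e \<in> ?K" for \<sigma>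
  proof -
    obtain \<rho> where r: "\<rho> \<subseteq> X" "\<sigma> = f ` \<rho>" using s(1) by (meson subset_image_iff)
    have "A p q" if pq: "p \<in> \<rho>" "q \<in> \<rho>" for p q
    proof (cases "p = q")
      case True
      then show ?thesis using assms(3) r pq by auto
    next
      case False
      then have "f p \<noteq> f q" using assms(2) r pq by (meson inj_onD subsetD)
      then have "f ` {p, q} \<in> ?K" using s(2) r pq by auto
      then show ?thesis using mem[of "{p, q}"] r pq by auto
    qed
    then show ?thesis using mem[OF r(1)] r(2) by blast
  qed
  ultimately show ?thesis unfolding flag_complex_def by blast
qed

section \<open>Four clusters in a plane\<close>

lemma exists_cluster_positions:
  assumes "CARD('d::finite) \<ge> 2" and "0 < \<alpha>" "\<alpha> < 1"
  obtains pos :: "nat \<times> nat \<Rightarrow> real ^ 'd" where "inj_on pos ({..<4} \<times> UNIV)"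
    "\<And>c i j. dist (pos (c, i)) (pos (c, j)) \<le> \<alpha>"
    "\<And>c c' i j. c < c' \<Longrightarrow> c' < 4 \<Longrightarrow> \<alpha> < dist (pos (c, i)) (pos (c', j))"
    "\<And>c c' i j. c < c' \<Longrightarrow> c' < 4 \<Longrightarrow> c < 2 \<Longrightarrow> dist (pos (c, i)) (pos (c', j)) \<le> 1"
proof -
  obtain a b :: 'd where "a \<noteq> b"
    using assms(1) by (metis (full_types) card_2_iff' card_le_Suc0_iff_eq finite UNIV_I One_nat_def not_less_eq_eq numeral_2_eq_2)
  \<comment> \<open>\<open>s\<close> is the midpoint of \<alpha> and 1; changing a distance
    \<open>s\<close> by at most \<open>\<epsilon>\<close> keeps it above \<alpha> and at most 1, and
    clusters of extent \<open>\<epsilon>\<close> have diameter at most \<alpha>.\<close>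
  define s where "s = (1 + \<alpha>) / 2"
  define \<epsilon> where "\<epsilon> = min ((1 - \<alpha>) / 4) \<alpha>"
  have s: "s > 0" and \<epsilon>: "\<epsilon> > 0" "\<epsilon> \<le> \<alpha>" "\<alpha> < s - \<epsilon>" "s + \<epsilon> \<le> 1"
    using assms(2,3) by (auto simp: s_def \<epsilon>_def min_def field_simps)
  define vec :: "real \<Rightarrow> real \<Rightarrow> real ^ 'd" where "vec p q = p *\<^sub>R axis a 1 + q *\<^sub>R axis b 1" for p q
  have norm_vec: "norm (vec p q) = sqrt (p\<^sup>2 + q\<^sup>2)" for p q
    using \<open>a \<noteq> b\<close> by (simp add: vec_def norm_eq_sqrt_inner inner_add_left inner_add_right inner_axis_axis power2_eq_square)
  have vec_diff: "vec p q - vec p' q' = vec (p - p') (q - q')" for p q p' q'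
    by (simp add: vec_def algebra_simps)
  define h where "h = s * sqrt 3 / 2"
  have h: "h\<^sup>2 = 3 / 4 * s\<^sup>2" by (simp add: h_def power_mult_distrib power_divide)
  \<comment> \<open>Two equilateral triangles of side \<open>s\<close> glued along the segment
    between centres 0 and 1. Only centres 2 and 3 are farther apart, at distance
    \<open>2 * h\<close>.\<close>
  define centre :: "nat \<Rightarrow> real ^ 'd" where
    "centre c = (if c = 0 then vec 0 0 else if c = 1 then vec s 0 else if c = 2 then vec (s / 2) h else vec (s / 2) (- h))" for c
  have unit: "sqrt (s\<^sup>2) = s" "sqrt ((s / 2)\<^sup>2 + h\<^sup>2) = s" "sqrt ((2 * h)\<^sup>2) \<ge> s"
  proof -
    show "sqrt (s\<^sup>2) = s" using s by simp
    have "(s / 2)\<^sup>2 + h\<^sup>2 = s\<^sup>2" unfolding h by (simp add: power2_eq_square)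
    then show "sqrt ((s / 2)\<^sup>2 + h\<^sup>2) = s" using s by simp
    have "s\<^sup>2 \<le> (2 * h)\<^sup>2" unfolding power_mult_distrib h by simp
    then show "sqrt ((2 * h)\<^sup>2) \<ge> s" using s by (metis real_le_rsqrt)
  qed
  have centre_dist: "dist (centre c) (centre c') \<ge> s \<and> (c < 2 \<longrightarrow> dist (centre c) (centre c') = s)"
    if "c < c'" "c' < 4" for c c'
  proof -
    have "(c, c') \<in> {(0, 1), (0, 2), (0, 3), (1, 2), (1, 3), (2, 3)}" using that by auto
    then show ?thesis using unit
      by (auto simp: centre_def dist_norm vec_diff norm_vec power2_commute[of 0] simp flip: power2_eq_square)
  qed
  \<comment> \<open>The offsets are distinct numbers in an interval of length
    \<open>\<epsilon>\<close>, so a cluster has room for any number of points.\<close>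
  define pos :: "nat \<times> nat \<Rightarrow> real ^ 'd" where
    "pos = (\<lambda>(c, i). centre c + (\<epsilon> / (real i + 1)) *\<^sub>R axis a 1)"
  have shift: "\<bar>\<epsilon> / (real i + 1) - \<epsilon> / (real j + 1)\<bar> \<le> \<epsilon>" for i j
  proof -
    have "0 < \<epsilon> / (real i + 1)" "\<epsilon> / (real i + 1) \<le> \<epsilon>" for i
      using \<epsilon>(1) by (simp_all add: field_simps)
    from this[of i] this[of j] show ?thesis by linarith
  qed
  have pos_diff: "pos (c, i) - pos (c', j) =
      (centre c - centre c') + (\<epsilon> / (real i + 1) - \<epsilon> / (real j + 1)) *\<^sub>R axis a 1" for c c' i j
    by (simp add: pos_def algebra_simps)
  have pos_dist: "\<bar>dist (pos (c, i)) (pos (c', j)) - dist (centre c) (centre c')\<bar> \<le> \<epsilon>" for c c' i j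
  proof -
    have "\<bar>dist (pos (c, i)) (pos (c', j)) - dist (centre c) (centre c')\<bar>
        \<le> norm ((pos (c, i) - pos (c', j)) - (centre c - centre c'))"
      unfolding dist_norm by (rule norm_triangle_ineq3)
    also have "\<dots> = \<bar>\<epsilon> / (real i + 1) - \<epsilon> / (real j + 1)\<bar>"
      unfolding pos_diff by simp
    also have "\<dots> \<le> \<epsilon>" by (rule shift)
    finally show ?thesis .
  qed
  have near: "dist (pos (c, i)) (pos (c, j)) \<le> \<alpha>" for c i j
    using pos_dist[of c i c j] \<epsilon>(2) by simp
  have far: "\<alpha> < dist (pos (c, i)) (pos (c', j))" if "c < c'" "c' < 4" for c c' i j
    using pos_dist[of c i c' j] centre_dist[OF that] \<epsilon> by linarith
  have le1: "dist (pos (c, i)) (pos (c', j)) \<le> 1" if "c < c'" "c' < 4" "c < 2" for c c' i j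
    using pos_dist[of c i c' j] centre_dist[OF that(1,2)] that(3) \<epsilon> by linarith
  have "inj_on pos ({..<4} \<times> UNIV)"
  proof (rule inj_onI, clarify)
    fix c i c' j assume *: "c < 4" "c' < (4::nat)" "pos (c, i) = pos (c', j)"
    have "c = c'"
    proof (rule linorder_cases[of c c'])
      assume "c < c'"
      then show ?thesis using far[of c c' i j] * assms(2) by simp
    next
      assume "c' < c"
      then show ?thesis using far[of c' c j i] * assms(2) by simp
    qed
    then have "(\<epsilon> / (real i + 1) - \<epsilon> / (real j + 1)) *\<^sub>R axis a (1::real) = 0"
      using pos_diff[of c i c' j] *(3) by simp
    then have "\<epsilon> / (real i + 1) = \<epsilon> / (real j + 1)" by (simp add: axis_eq_0_iff)
    then have "i = j" using \<epsilon>(1) by (simp add: field_simps)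
    with \<open>c = c'\<close> show "c = c' \<and> i = j" by simp
  qed
  then show ?thesis using near far le1 by (rule that)
qed

section \<open>The two bounds\<close>

text \<open>Three clusters of at most \<open>m\<close> points and the apex fit into \<open>n\<close>
  points; the summand \<open>m\<close> on the right pays for one base edge in each of at most
  \<open>m\<close> matchings.\<close>

lemma quasi_rips_reduced_betti_2_ge:
  assumes "CARD('d::finite) \<ge> 2" and "0 < \<alpha>" "\<alpha> < 1" and "3 * m + 1 \<le> n"
  shows "\<exists>\<Gamma> \<in> (quasi_rips_complexes \<alpha> n :: (real ^ 'd) set set set).
    max_induced_matchings m \<le> reduced_betti TYPE('k::field) 2 \<Gamma> + m"
proof -
  obtain U V :: "nat set" and E t M where UV: "finite U" "finite V" "card U \<le> m" "card V \<le> m" "E \<subseteq> U \<times> V"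
    and t: "t \<le> m" and ind: "\<And>i. i \<in> {1..t} \<Longrightarrow> induced_matching E (M i)"
    and disj: "disjoint_family_on M {1..t}"
    and max: "max_induced_matchings m = (\<Sum>i = 1..t. card (M i))"
    by (rule max_induced_matchings_attained[of m]) (rule that)
  obtain pos :: "nat \<times> nat \<Rightarrow> real ^ 'd" where pos: "inj_on pos ({..<4} \<times> UNIV)"
    "\<And>c i j. dist (pos (c, i)) (pos (c, j)) \<le> \<alpha>"
    "\<And>c c' i j. c < c' \<Longrightarrow> c' < 4 \<Longrightarrow> \<alpha> < dist (pos (c, i)) (pos (c', j))"
    "\<And>c c' i j. c < c' \<Longrightarrow> c' < 4 \<Longrightarrow> c < 2 \<Longrightarrow> dist (pos (c, i)) (pos (c', j)) \<le> 1"
    by (rule exists_cluster_positions[OF assms(1-3)]) (rule that)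
  define X where "X = {0::nat} \<times> U \<union> {1} \<times> V \<union> {2} \<times> {1..t} \<union> {(3, 0)}"
  \<comment> \<open>Labels 0, 1, 2, 3 stand for \<open>U\<close>, \<open>V\<close>, the matching
    indices and the apex. Equal labels must be adjacent, as points of one cluster are within
    \<alpha>; labels 2 and 3 are never adjacent.\<close>
  define R :: "nat \<times> nat \<Rightarrow> nat \<times> nat \<Rightarrow> bool" where "R = (\<lambda>(c, i) (c', j). c = c' \<or>
    (c = 0 \<and> c' = 1 \<and> (i, j) \<in> E) \<or> (c = 0 \<and> c' = 2 \<and> i \<in> fst ` M j) \<or>
    (c = 1 \<and> c' = 2 \<and> i \<in> snd ` M j) \<or> (c < 2 \<and> c' = 3))"
  define A where "A p q \<longleftrightarrow> R p q \<or> R q p" for p q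
  have A_refl: "A p p" for p by (auto simp: A_def R_def)
  have A_sym: "A p q \<Longrightarrow> A q p" for p q by (auto simp: A_def)
  have adj: "A (c, i) (c, j)" "A (0, i) (1, j) \<longleftrightarrow> (i, j) \<in> E" "A (1, i) (0, j) \<longleftrightarrow> (j, i) \<in> E"
    "A (0, i) (2, j) \<longleftrightarrow> i \<in> fst ` M j" "A (2, i) (0, j) \<longleftrightarrow> j \<in> fst ` M i"
    "A (1, i) (2, j) \<longleftrightarrow> i \<in> snd ` M j" "A (2, i) (1, j) \<longleftrightarrow> j \<in> snd ` M i"
    "A (3, i) (0, j)" "A (3, i) (1, j)" "\<not> A (3, i) (2, j)" for c i j
    by (simp_all add: A_def R_def)
  define \<Gamma> where "\<Gamma> = clique_complex_image pos X A"
  have finX: "finite X" using UV by (simp add: X_def)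
  have X4: "X \<subseteq> {..<4} \<times> UNIV" by (auto simp: X_def)
  have injX: "inj_on pos X" using inj_on_subset[OF pos(1) X4] .
  have pos_eq: "pos (c, i) = pos (c', j) \<longleftrightarrow> c = c' \<and> i = j" if "c < 4" "c' < 4" for c c' i j
    using inj_on_eq_iff[OF pos(1), of "(c, i)" "(c', j)"] that by simp
  have flag: "flag_complex (pos ` X) \<Gamma>"
    unfolding \<Gamma>_def using finX injX
    by (rule flag_complex_clique_complex_image) (rule A_refl)
  then have complex: "simplicial_complex (pos ` X) \<Gamma>" by (simp add: flag_complex_def)
  then have faces: "\<forall>\<sigma>\<in>\<Gamma>. \<sigma> \<subseteq> pos ` X" by (simp add: simplicial_complex_def)
  note mem = image_in_clique_complex_image[OF injX, of _ A, folded \<Gamma>_def]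
  have cardX: "card (pos ` X) \<le> n"
  proof -
    have "card X \<le> card ({0::nat} \<times> U) + card ({1::nat} \<times> V) + card ({2::nat} \<times> {1..t}) + card {(3::nat, 0::nat)}"
      unfolding X_def by (intro order_trans[OF card_Un_le] add_mono order_refl)
    also have "\<dots> \<le> n" using UV t assms(4) by (simp add: card_cartesian_product)
    finally show ?thesis using card_image_le[OF finX, of pos] by linarith
  qed
  have quasi: "quasi_rips \<alpha> (pos ` X) \<Gamma>"
    unfolding quasi_rips_def
  proof (intro conjI flag ballI impI)
    fix a b assume "a \<in> pos ` X" "b \<in> pos ` X" "a \<noteq> b"
    then obtain c i c' j where p: "(c, i) \<in> X" "a = pos (c, i)" "(c', j) \<in> X" "b = pos (c', j)" by auto
    have c: "c < 4" "c' < 4" using p X4 by auto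
    have "{a, b} = pos ` {(c, i), (c', j)}" using p by simp
    then have iff: "{a, b} \<in> \<Gamma> \<longleftrightarrow> A (c, i) (c', j)"
      using mem[of "{(c, i), (c', j)}"] p A_refl A_sym[of "(c, i)" "(c', j)"] by auto
    show "{a, b} \<in> \<Gamma>" if "dist a b \<le> \<alpha>"
    proof -
      have "c = c'"
      proof (rule linorder_cases[of c c'])
        assume "c < c'"
        then show ?thesis using pos(3)[of c c' i j] that p c by simp
      next
        assume "c' < c"
        then show ?thesis using pos(3)[of c' c j i] that p c by (simp add: dist_commute)
      qed
      then show ?thesis by (simp add: iff A_def R_def)
    qed
    show "{a, b} \<notin> \<Gamma>" if "1 < dist a b"
    proof
      assume "{a, b} \<in> \<Gamma>"
      then have "c = c' \<or> c < c' \<and> c < 2 \<or> c' < c \<and> c' < 2" by (auto simp: iff A_def R_def)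
      then show False
        using pos(2)[of c i j] pos(4)[of c c' i j] pos(4)[of c' c j i] that p c assms(3)
        by (auto simp: dist_commute)
    qed
  qed
  \<comment> \<open>For an empty \<open>M i\<close> the choice is arbitrary, but then
    \<open>J\<close> has no element over \<open>i\<close>.\<close>
  define base where "base i = (SOME e. e \<in> M i)" for i
  define J where "J = Sigma {1..t} (\<lambda>i. M i - {base i})"
  have ME: "M i \<subseteq> E" if "i \<in> {1..t}" for i using induced_matchingD(1)[OF ind[OF that]] .
  have finM: "finite (M i)" if "i \<in> {1..t}" for i
    using ME[OF that] UV by (meson finite_SigmaI finite_subset)
  have J: "i \<in> {1..t} \<and> (a, b) \<in> M i \<and> (a, b) \<noteq> base i \<and> base i \<in> M i \<and> (a, b) \<in> E \<and> base i \<in> E \<and>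
      a \<in> U \<and> b \<in> V \<and> fst (base i) \<in> U \<and> snd (base i) \<in> V" if "(i, a, b) \<in> J" for i a b
  proof -
    have i: "i \<in> {1..t}" and ab: "(a, b) \<in> M i" "(a, b) \<noteq> base i" using that by (auto simp: J_def)
    have b: "base i \<in> M i" unfolding base_def using ab(1) by (rule someI)
    have "(a, b) \<in> E" "base i \<in> E" using ME[OF i] ab b by blast+
    moreover from this have "a \<in> U" "b \<in> V" "fst (base i) \<in> U" "snd (base i) \<in> V" using UV(5) by auto
    ultimately show ?thesis using i ab b by blast
  qed
  \<comment> \<open>The poles are the index \<open>i\<close> and the apex. The equator has four
    sides: the edge \<open>(a, b)\<close>, the base edge, and one edge inside each of the clusters
    \<open>U\<close> and \<open>V\<close>.\<close>
  have "card J \<le> reduced_betti TYPE('k) 2 \<Gamma>"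
  proof (rule octahedra_reduced_betti_ge[where S = "pos ` X" and w = "\<lambda>(i, a, b). pos (2, i)"
        and x = "\<lambda>_. pos (3, 0)" and u = "\<lambda>(i, a, b). pos (0, a)" and v = "\<lambda>(i, a, b). pos (1, b)"
        and u' = "\<lambda>(i, a, b). pos (0, fst (base i))" and v' = "\<lambda>(i, a, b). pos (1, snd (base i))"])
    show "simplicial_complex (pos ` X) \<Gamma>" by (rule complex)
    show "finite (pos ` X)" using finX by simp
    show "finite J" unfolding J_def using finM by auto
  next
    fix j p q r assume "j \<in> J"
      and pqr: "p \<in> {case j of (i, a, b) \<Rightarrow> pos (2, i), pos (3, 0)}"
        "q \<in> {case j of (i, a, b) \<Rightarrow> pos (0, a), case j of (i, a, b) \<Rightarrow> pos (1, snd (base i))}"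
        "r \<in> {case j of (i, a, b) \<Rightarrow> pos (1, b), case j of (i, a, b) \<Rightarrow> pos (0, fst (base i))}"
    obtain i a b where j: "j = (i, a, b)" by (cases j)
    note J' = J[OF \<open>j \<in> J\<close>[unfolded j]]
    obtain p' q' r' where l: "p = pos p'" "q = pos q'" "r = pos r'" "p' = (2, i) \<or> p' = (3, 0)"
      "q' = (0, a) \<or> q' = (1, snd (base i))" "r' = (1, b) \<or> r' = (0, fst (base i))"
      using pqr by (auto simp: j)
    have sub: "{p', q', r'} \<subseteq> X" using l(4-6) J' by (auto simp: X_def)
    have "a \<in> fst ` M i" "fst (base i) \<in> fst ` M i" "b \<in> snd ` M i" "snd (base i) \<in> snd ` M i"
      using J' by (auto intro: rev_image_eqI)
    then have "A (2, i) (0, a)" "A (2, i) (0, fst (base i))" "A (2, i) (1, b)" "A (2, i) (1, snd (base i))"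
      unfolding adj by simp_all
    moreover have "A (0, a) (1, b)" "A (1, snd (base i)) (0, fst (base i))" using J' unfolding adj by simp_all
    ultimately have "A p' q'" "A p' r'" "A q' r'"
      using l(4-6) adj(1,8,9) by metis+
    then have "\<forall>x\<in>{p', q', r'}. \<forall>y\<in>{p', q', r'}. A x y" using A_refl A_sym by simp
    then have "pos ` {p', q', r'} \<in> \<Gamma>" using mem[OF sub] by blast
    then show "{p, q, r} \<in> \<Gamma>" using l by simp
  next
    fix j y assume "j \<in> J"
      and y: "y \<notin> {case j of (i, a, b) \<Rightarrow> pos (2, i), case j of (i, a, b) \<Rightarrow> pos (0, a), case j of (i, a, b) \<Rightarrow> pos (1, b)}"
    obtain i a b where j: "j = (i, a, b)" by (cases j)
    note J' = J[OF \<open>j \<in> J\<close>[unfolded j]]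
    \<comment> \<open>A fourth vertex in \<open>U\<close> or \<open>V\<close> contradicts that
      \<open>M i\<close> is induced. A second index \<open>k\<close> contradicts that
      \<open>M k\<close> is induced, or, if \<open>(a, b)\<close> is in \<open>M k\<close>, that the
      matchings are disjoint. The apex is not adjacent to \<open>i\<close>.\<close>
    have "insert y {pos (2, i), pos (0, a), pos (1, b)} \<notin> \<Gamma>"
    proof
      assume face: "insert y {pos (2, i), pos (0, a), pos (1, b)} \<in> \<Gamma>"
      have "y \<in> pos ` X" using bspec[OF faces face] by simp
      then obtain c k where ck: "(c, k) \<in> X" "y = pos (c, k)" by auto
      have "{(c, k), (2, i), (0, a), (1, b)} \<subseteq> X" using J' ck by (auto simp: X_def)
      moreover have "pos ` {(c, k), (2, i), (0, a), (1, b)} \<in> \<Gamma>" using face ck by simp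
      ultimately have "\<forall>p\<in>{(c, k), (2, i), (0, a), (1, b)}. \<forall>q\<in>{(c, k), (2, i), (0, a), (1, b)}. A p q"
        using mem by blast
      then have A: "A (c, k) (2, i)" "A (c, k) (0, a)" "A (c, k) (1, b)" by simp_all
      have ne: "(c, k) \<noteq> (2, i)" "(c, k) \<noteq> (0, a)" "(c, k) \<noteq> (1, b)" using y ck j by auto
      have no: "(u', v) \<notin> E" if "k \<in> {1..t}" "(u', v') \<in> M k" "(u, v) \<in> M k" "(u', v') \<noteq> (u, v)" for k u v u' v'
        using induced_matchingD(2)[OF ind[OF that(1)] that(2-4)] .
      consider "c = 0" "k \<noteq> a" | "c = 1" "k \<noteq> b" | "c = 2" "k \<noteq> i" "k \<in> {1..t}" | "c = 3"
        using ck(1) ne by (auto simp: X_def)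
      then show False
      proof cases
        case 1
        have "k \<in> fst ` M i" "(k, b) \<in> E" using A(1,3) unfolding 1(1) adj by simp_all
        then obtain b' where "(k, b') \<in> M i" "(k, b) \<in> E" by auto
        then show False using no[of i k b' a b] J' 1 by simp
      next
        case 2
        have "k \<in> snd ` M i" "(a, k) \<in> E" using A(1,2) unfolding 2(1) adj by simp_all
        then obtain a' where "(a', k) \<in> M i" "(a, k) \<in> E" by auto
        then show False using no[of i a b a' k] J' 2 by simp
      next
        case 3
        have "a \<in> fst ` M k" "b \<in> snd ` M k" using A(2,3) unfolding 3(1) adj by simp_all
        then obtain a' b' where ab': "(a, b') \<in> M k" "(a', b) \<in> M k" by auto
        show False
        proof (cases "(a, b') = (a', b)")
          case True
          then have "(a, b) \<in> M k \<inter> M i" using ab' J' by simp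
          moreover have "M k \<inter> M i = {}" using disjoint_family_onD[OF disj, of k i] 3 J' by simp
          ultimately show False by blast
        next
          case False
          then show False using no[OF 3(3) ab'] J' by simp
        qed
      next
        case 4
        show False using A(1) unfolding 4 by (simp add: adj(10))
      qed
    qed
    then show "insert y {case j of (i, a, b) \<Rightarrow> pos (2, i), case j of (i, a, b) \<Rightarrow> pos (0, a), case j of (i, a, b) \<Rightarrow> pos (1, b)} \<notin> \<Gamma>"
      by (simp add: j)
  next
    fix j j' assume jj: "j \<in> J" "j' \<in> J"
    obtain i a b where j: "j = (i, a, b)" by (cases j)
    obtain i' a' b' where j': "j' = (i', a', b')" by (cases j')
    show "(case j of (i, a, b) \<Rightarrow> pos (2, i)) \<notin> {pos (3, 0), case j' of (i, a, b) \<Rightarrow> pos (0, a), case j' of (i, a, b) \<Rightarrow> pos (1, b),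
        case j' of (i, a, b) \<Rightarrow> pos (0, fst (base i)), case j' of (i, a, b) \<Rightarrow> pos (1, snd (base i))} \<and>
      (case j of (i, a, b) \<Rightarrow> pos (0, a)) \<notin> {case j' of (i, a, b) \<Rightarrow> pos (2, i), pos (3, 0), case j' of (i, a, b) \<Rightarrow> pos (1, b),
        case j' of (i, a, b) \<Rightarrow> pos (1, snd (base i))} \<and>
      (case j of (i, a, b) \<Rightarrow> pos (1, b)) \<notin> {case j' of (i, a, b) \<Rightarrow> pos (2, i), pos (3, 0), case j' of (i, a, b) \<Rightarrow> pos (0, a),
        case j' of (i, a, b) \<Rightarrow> pos (0, fst (base i))}"
      by (simp add: j j' pos_eq)
    assume w: "(case j of (i, a, b) \<Rightarrow> pos (2, i)) = (case j' of (i, a, b) \<Rightarrow> pos (2, i))"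
    show "(case j of (i, a, b) \<Rightarrow> pos (0, a)) \<noteq> (case j' of (i, a, b) \<Rightarrow> pos (0, fst (base i)))"
    proof
      assume "(case j of (i, a, b) \<Rightarrow> pos (0, a)) = (case j' of (i, a, b) \<Rightarrow> pos (0, fst (base i)))"
      then have "i = i'" "a = fst (base i)" using w by (simp_all add: j j' pos_eq)
      then have "(a, snd (base i)) \<in> E" "(a, snd (base i)) \<in> M i" "(a, b) \<noteq> (a, snd (base i))"
        using J[OF jj(1)[unfolded j]] by auto
      then show False using J[OF jj(1)[unfolded j]] induced_matchingD(2)[OF ind, of i a b a "snd (base i)"] by auto
    qed
    assume "(case j of (i, a, b) \<Rightarrow> pos (0, a)) = (case j' of (i, a, b) \<Rightarrow> pos (0, a))"
      "(case j of (i, a, b) \<Rightarrow> pos (1, b)) = (case j' of (i, a, b) \<Rightarrow> pos (1, b))"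
    then show "j = j'" using w by (simp add: j j' pos_eq)
  qed
  moreover have "max_induced_matchings m \<le> card J + m"
  proof -
    have "card (M i) \<le> card (M i - {base i}) + 1" if "i \<in> {1..t}" for i
      using finM[OF that] by (auto simp: card_Diff_singleton_if)
    then have "(\<Sum>i = 1..t. card (M i)) \<le> (\<Sum>i = 1..t. card (M i - {base i}) + 1)" by (rule sum_mono)
    also have "\<dots> = card J + t" unfolding J_def using finM by (simp add: sum_Suc card_SigmaI)
    finally show ?thesis using max t by simp
  qed
  moreover have "\<Gamma> \<in> quasi_rips_complexes \<alpha> n"
    unfolding quasi_rips_complexes_def using finX cardX quasi by blast
  ultimately show ?thesis by (intro bexI[of _ \<Gamma>]) auto
qed

theorem theorem6p1:
  fixes \<alpha> :: real
  assumes "CARD('d::finite) \<ge> 2" and "0 < \<alpha>" and "\<alpha> < 1"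
  shows "\<exists>C D :: real. C > 0 \<and>
    (\<forall>\<^sub>F n in sequentially.
       C * real (max_induced_matchings n) < real (max_betti TYPE('k::field) TYPE('d) \<alpha> 2 n) \<and>
       real (max_betti TYPE('k) TYPE('d) \<alpha> 2 n) < D * real (max_induced_matchings n))"
proof -
  obtain D :: nat where D: "\<And>n \<Gamma>. \<Gamma> \<in> (quasi_rips_complexes \<alpha> n :: (real ^ 'd) set set set) \<Longrightarrow>
    reduced_betti TYPE('k) 2 \<Gamma> \<le> D * max_induced_matchings n"
    by (rule quasi_rips_reduced_betti_2_le[OF assms(2)]) (rule that)
  have "1 / 256 * real (max_induced_matchings n) < real (max_betti TYPE('k) TYPE('d) \<alpha> 2 n) \<and>
      real (max_betti TYPE('k) TYPE('d) \<alpha> 2 n) < real (D + 1) * real (max_induced_matchings n)"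
    if n: "n \<ge> 36" for n
  proof -
    let ?B = "{reduced_betti TYPE('k) 2 \<Gamma> | \<Gamma>. \<Gamma> \<in> (quasi_rips_complexes \<alpha> n :: (real ^ 'd) set set set)}"
    \<comment> \<open>Large enough that four parts of size \<open>m\<close> cover \<open>n\<close>,
      small enough that three clusters and the apex fit; \<open>n \<ge> 36\<close> also yields
      \<open>m \<ge> 9\<close>, as the linear lower bound requires.\<close>
    define m where "m = n div 4 + 1"
    have m: "n \<le> 4 * m" "3 * m + 1 \<le> n" "m \<ge> 9" using n unfolding m_def by presburger+
    have ub: "b \<le> D * max_induced_matchings n" if "b \<in> ?B" for b using that D by blast
    \<comment> \<open>The upper bound also shows that the \<open>Max\<close> in
      \<open>max_betti\<close> ranges over a finite set.\<close>
    then have fin: "finite ?B" by (meson finite_nat_set_iff_bounded_le)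
    obtain \<Gamma> where \<Gamma>: "\<Gamma> \<in> (quasi_rips_complexes \<alpha> n :: (real ^ 'd) set set set)"
      "max_induced_matchings m \<le> reduced_betti TYPE('k) 2 \<Gamma> + m"
      using quasi_rips_reduced_betti_2_ge[OF assms m(2)] by blast
    have mem: "reduced_betti TYPE('k) 2 \<Gamma> \<in> ?B" using \<Gamma>(1) by blast
    have max: "max_betti TYPE('k) TYPE('d) \<alpha> 2 n = Max ?B" by (simp add: max_betti_def)
    have "reduced_betti TYPE('k) 2 \<Gamma> \<le> max_betti TYPE('k) TYPE('d) \<alpha> 2 n"
      unfolding max by (rule Max_ge[OF fin mem])
    then have lower: "max_induced_matchings m \<le> max_betti TYPE('k) TYPE('d) \<alpha> 2 n + m" using \<Gamma>(2) by linarith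
    have "Max ?B \<in> ?B" using fin mem by (intro Max_in) blast+
    then have upper: "max_betti TYPE('k) TYPE('d) \<alpha> 2 n \<le> D * max_induced_matchings n"
      unfolding max by (rule ub)
    have pos: "max_induced_matchings n > 0" using max_induced_matchings_ge[of n] n by linarith
    \<comment> \<open>Since \<open>2 * m\<close> is at most \<open>max_induced_matchings m\<close>,
      the loss of \<open>m\<close> costs at most a factor 2, and passing from \<open>m\<close> to
      \<open>n\<close> costs 64. Doubling 128 to 256, like taking \<open>D + 1\<close> for
      \<open>D\<close>, makes the inequality strict.\<close>
    have "max_induced_matchings n \<le> 128 * max_betti TYPE('k) TYPE('d) \<alpha> 2 n"
      using lower max_induced_matchings_ge[OF m(3)] max_induced_matchings_quarter[OF m(1)] by linarith
    then have "1 / 256 * real (max_induced_matchings n) < real (max_betti TYPE('k) TYPE('d) \<alpha> 2 n)"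
      using pos by linarith
    moreover have "max_betti TYPE('k) TYPE('d) \<alpha> 2 n < (D + 1) * max_induced_matchings n"
      using upper pos by simp
    then have "real (max_betti TYPE('k) TYPE('d) \<alpha> 2 n) < real (D + 1) * real (max_induced_matchings n)"
      unfolding of_nat_mult[symmetric] of_nat_less_iff .
    ultimately show ?thesis by blast
  qed
  then show ?thesis
    by (intro exI[of _ "1 / 256"] exI[of _ "real (D + 1)"] conjI eventually_sequentiallyI[of 36]) auto
qed

end
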